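(* Let $C$ denote the set $[-1,1]\times(0,1]\subset\mathbb{R}^2\equiv\mathbb{C}$ endowed with the conformal structure induced by $\mathbb{C}$. Then there exists $X\in\mathcal{M}(C)$ such that: (1) $(x_1,x_3)\circ X:C\to\mathbb{R}^2$ is proper. (2) If we set $f:C\to(-\infty,0]$, $f:=\min\big\{\frac{x_3\circ X}{|x_1\circ X|+1},0\big\}$, then $f=0$ on $(x_1\circ X)^{-1}((-\infty,0])$, and $\lim_{n\to\infty}f(P_n)=0$ for any divergent sequence $\{P_n\}_{n\in\mathbb{N}}$ in $C$.
   Context: $\mathcal{M}(C)$ denotes the space of conformal minimal immersions into $\mathbb{R}^3$ of open domains of $\mathbb{C}$ containing $C$. $x_k:\mathbb{R}^3\to\mathbb{R}$ is the $k$-th coordinate function. A sequence in $C$ is divergent if it eventually leaves every compact subset of $C$. *)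

theory Defs
  imports "HOL-Analysis.Analysis"
begin

definition dir_deriv ::
  "complex \<Rightarrow> (complex \<Rightarrow> 'a::real_normed_vector) \<Rightarrow> complex \<Rightarrow> 'a" where
  "dir_deriv v f z = frechet_derivative f (at z) v"

text \<open>With \<open>z = x + \<i> y\<close>, the partial derivatives in \<open>x\<close> and \<open>y\<close> are the directional
  derivatives along \<open>1\<close> and \<open>\<i>\<close>. In the definitions of smoothness below the set \<open>U\<close> is meant to
  be open.\<close>

primrec Ck_on ::
  "nat \<Rightarrow> complex set \<Rightarrow> (complex \<Rightarrow> 'a::real_normed_vector) \<Rightarrow> bool" where
  "Ck_on 0 U f \<longleftrightarrow> continuous_on U f"
| "Ck_on (Suc k) U f \<longleftrightarrow> f differentiable_on U \<and> (\<forall>v. Ck_on k U (dir_deriv v f))"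

definition smooth_on :: "complex set \<Rightarrow> (complex \<Rightarrow> 'a::real_normed_vector) \<Rightarrow> bool" where
  "smooth_on U f \<longleftrightarrow> (\<forall>k. Ck_on k U f)"

definition unit_normal :: "(complex \<Rightarrow> real^3) \<Rightarrow> complex \<Rightarrow> real^3" where
  "unit_normal X z = sgn (cross3 (dir_deriv 1 X z) (dir_deriv \<i> X z))"

text \<open>The bilinear forms \<open>I\<close> and \<open>II\<close> of the immersed surface, evaluated on coordinate directions,
  and \<open>H = (E n - 2 F m + G l) / (2 (E G - F\<^sup>2))\<close>.\<close>

definition first_form :: "(complex \<Rightarrow> real^3) \<Rightarrow> complex \<Rightarrow> complex \<Rightarrow> complex \<Rightarrow> real" where
  "first_form X z v w = dir_deriv v X z \<bullet> dir_deriv w X z"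

definition second_form :: "(complex \<Rightarrow> real^3) \<Rightarrow> complex \<Rightarrow> complex \<Rightarrow> complex \<Rightarrow> real" where
  "second_form X z v w = dir_deriv v (dir_deriv w X) z \<bullet> unit_normal X z"

definition mean_curvature :: "(complex \<Rightarrow> real^3) \<Rightarrow> complex \<Rightarrow> real" where
  "mean_curvature X z =
    (first_form X z 1 1 * second_form X z \<i> \<i>
      - 2 * first_form X z 1 \<i> * second_form X z 1 \<i>
      + first_form X z \<i> \<i> * second_form X z 1 1)
    / (2 * (first_form X z 1 1 * first_form X z \<i> \<i> - (first_form X z 1 \<i>)\<^sup>2))"

definition immersion_on :: "complex set \<Rightarrow> (complex \<Rightarrow> real^3) \<Rightarrow> bool" where
  "immersion_on U X \<longleftrightarrow> smooth_on U X \<and> (\<forall>z\<in>U. inj (frechet_derivative X (at z)))"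

text \<open>Conformality: the metric induced by \<open>X\<close> is a positive multiple of the Euclidean one at each
  point; \<open>v \<bullet> w\<close> is the real inner product of the plane.\<close>

definition conformal_on :: "complex set \<Rightarrow> (complex \<Rightarrow> real^3) \<Rightarrow> bool" where
  "conformal_on U X \<longleftrightarrow> (\<forall>z\<in>U. \<exists>c>0. \<forall>v w. first_form X z v w = c * (v \<bullet> w))"

definition conformal_minimal_immersion_on :: "complex set \<Rightarrow> (complex \<Rightarrow> real^3) \<Rightarrow> bool" where
  "conformal_minimal_immersion_on U X \<longleftrightarrow>
    immersion_on U X \<and> conformal_on U X \<and> (\<forall>z\<in>U. mean_curvature X z = 0)"

text \<open>The space \<open>\<M>(C)\<close>. Its members are total functions; their values off the domain \<open>U\<close> are
  irrelevant.\<close>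

definition conformal_minimal_immersions :: "complex set \<Rightarrow> (complex \<Rightarrow> real^3) set" where
  "conformal_minimal_immersions C =
    {X. \<exists>U. open U \<and> connected U \<and> C \<subseteq> U \<and> conformal_minimal_immersion_on U X}"

definition divergent_seq_in :: "complex set \<Rightarrow> (nat \<Rightarrow> complex) \<Rightarrow> bool" where
  "divergent_seq_in C P \<longleftrightarrow>
    (\<forall>n. P n \<in> C) \<and> (\<forall>K. compact K \<and> K \<subseteq> C \<longrightarrow> (\<forall>\<^sub>F n in sequentially. P n \<notin> K))"

definition half_open_rectangle :: "complex set" where
  "half_open_rectangle = {z. Re z \<in> {-1..1} \<and> Im z \<in> {0<..1}}"

end

theory Submission
  imports Defs "HOL-Complex_Analysis.Complex_Analysis"
    "HOL-Computational_Algebra.Fundamental_Theorem_Algebra"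
begin

text \<open>
  On a sequence of disjoint horizontal strips shrinking to the segment \<open>Im z = 0\<close> one can prescribe
  a holomorphic function \<open>h\<close> up to small errors by Runge approximation, without any control in the
  gaps between the strips. Making \<open>Re h\<close> large on the strips, \<open>x\<^sub>3 = Re h\<close> has the required
  behaviour there. The gaps are covered by a second family of disjoint strips, on which
  \<open>x\<^sub>1 = Re g\<close> is made so large that it dominates the (uncontrolled but finite) values of \<open>\<bar>h\<bar>\<close>.
  The derivatives \<open>g' = \<i>/2 (e\<^sup>W + h'\<^sup>2 e\<^sup>-\<^sup>W)\<close>, \<open>k' = -1/2 (e\<^sup>W - h'\<^sup>2 e\<^sup>-\<^sup>W)\<close> and \<open>h'\<close> have
  vanishing sum of squares and no common zero for every \<open>h\<close> and \<open>W\<close>, so only the integral of \<open>g'\<close>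
  has to be controlled. If \<open>W\<close> is close to \<open>0\<close> on the second family of strips, \<open>g\<close> varies little
  on each of them; if moreover \<open>W\<close> is nearly real and nonnegative along the imaginary axis, with a
  high plateau between consecutive strips, then \<open>Re g\<close> gains as much as desired from one strip to
  the next.
\<close>

section \<open>Weierstrass representation\<close>

lemma frechet_derivative_transform_within_open:
  assumes "open U" "z \<in> U" "\<And>w. w \<in> U \<Longrightarrow> f w = g w"
  shows "frechet_derivative f (at z) = frechet_derivative g (at z)"
proof -
  have "(f has_derivative D) (at z) \<longleftrightarrow> (g has_derivative D) (at z)" for D
    using assms by (metis has_derivative_transform_within_open)
  then show ?thesis
    by (simp add: frechet_derivative_def)
qed

lemma dir_deriv_cong:
  assumes "open U" "z \<in> U" "\<And>w. w \<in> U \<Longrightarrow> f w = g w"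
  shows "dir_deriv v f z = dir_deriv v g z"
  unfolding dir_deriv_def using frechet_derivative_transform_within_open[OF assms] by simp

text \<open>Directional derivatives are local, so on an open set the induction passes to them. Thus
  a formula for the derivative known only on \<open>U\<close> may be substituted inside
  \<open>Ck_on\<close>.\<close>

lemma Ck_on_cong:
  assumes "open U" "\<And>w. w \<in> U \<Longrightarrow> f w = g w"
  shows "Ck_on k U f \<longleftrightarrow> Ck_on k U g"
  using assms(2)
proof (induction k arbitrary: f g)
  case 0
  then show ?case by (auto cong: continuous_on_cong)
next
  case (Suc k)
  have diff: "q differentiable_on U" if p: "p differentiable_on U" and eq: "\<And>w. w \<in> U \<Longrightarrow> q w = p w"
    for p q :: "complex \<Rightarrow> 'a"
    unfolding differentiable_on_def
  proof
    fix x assume x: "x \<in> U"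
    then obtain D where "(p has_derivative D) (at x within U)"
      using p unfolding differentiable_on_def differentiable_def by blast
    then have "(q has_derivative D) (at x within U)"
      using x eq by (rule has_derivative_transform[rotated 2])
    then show "q differentiable at x within U"
      by (rule differentiableI)
  qed
  have "f differentiable_on U \<longleftrightarrow> g differentiable_on U"
    using diff[of f g] diff[of g f] Suc.prems by auto
  moreover have "Ck_on k U (dir_deriv v f) \<longleftrightarrow> Ck_on k U (dir_deriv v g)" for v
    by (rule Suc.IH) (metis Suc.prems dir_deriv_cong[OF assms(1)])
  ultimately show ?case by simp
qed

section \<open>Vectors of real parts of holomorphic functions\<close>

lemma has_derivative_Re_vec:
  fixes f :: "'n::finite \<Rightarrow> complex \<Rightarrow> complex"
  assumes "\<And>i. (f i has_field_derivative f' i) (at z)"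
  shows "((\<lambda>z. \<chi> i. Re (f i z)) has_derivative (\<lambda>v. \<chi> i. Re (f' i * v))) (at z)"
proof -
  have "((\<lambda>z. Re (f i z)) has_derivative (\<lambda>v. Re (f' i * v))) (at z)" for i
    using has_derivative_Re[OF assms[of i, unfolded has_field_derivative_def]] by simp
  then show ?thesis
    by (subst has_derivative_componentwise_within) (auto simp: Basis_vec_def inner_axis)
qed

context
  fixes U :: "complex set" and f :: "'n::finite \<Rightarrow> complex \<Rightarrow> complex"
  assumes U: "open U" and holo: "\<And>i. f i holomorphic_on U"
begin

lemma has_derivative_Re_vec_holomorphic:
  assumes "z \<in> U"
  shows "((\<lambda>z. \<chi> i. Re (f i z)) has_derivative (\<lambda>v. \<chi> i. Re (deriv (f i) z * v))) (at z)"
  by (rule has_derivative_Re_vec) (rule holomorphic_derivI[OF holo U assms])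

lemma frechet_derivative_Re_vec:
  assumes "z \<in> U"
  shows "frechet_derivative (\<lambda>z. \<chi> i. Re (f i z)) (at z) = (\<lambda>v. \<chi> i. Re (deriv (f i) z * v))"
  using frechet_derivative_at[OF has_derivative_Re_vec_holomorphic[OF assms]] by simp

lemma dir_deriv_Re_vec:
  assumes "z \<in> U"
  shows "dir_deriv v (\<lambda>z. \<chi> i. Re (f i z)) z = (\<chi> i. Re (deriv (f i) z * v))"
  by (simp add: dir_deriv_def frechet_derivative_Re_vec[OF assms])

end

text \<open>A directional derivative multiplies the complex derivatives by \<open>v\<close> and
  takes real parts, which is a map of the same form; the induction therefore runs over all
  \<open>f\<close> at once.\<close>

lemma smooth_on_Re_vec:
  fixes f :: "'n::finite \<Rightarrow> complex \<Rightarrow> complex"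
  assumes U: "open U" and holo: "\<And>i. f i holomorphic_on U"
  shows "smooth_on U (\<lambda>z. \<chi> i. Re (f i z))"
proof -
  have "Ck_on k U (\<lambda>z. \<chi> i. Re (f i z))" for k
    using holo
  proof (induction k arbitrary: f)
    case 0
    then show ?case
      by (auto intro!: continuous_intros holomorphic_on_imp_continuous_on)
  next
    case (Suc k)
    have "(\<lambda>z. \<chi> i. Re (f i z)) differentiable_on U"
      using has_derivative_Re_vec_holomorphic[where f = f, OF U Suc.prems]
      unfolding differentiable_on_def differentiable_def by (blast intro: has_derivative_at_withinI)
    moreover have "Ck_on k U (dir_deriv v (\<lambda>z. \<chi> i. Re (f i z)))" for v
    proof -
      have "Ck_on k U (\<lambda>z. \<chi> i. Re (deriv (f i) z * v))"
        using Suc.prems U by (intro Suc.IH holomorphic_intros) auto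
      then show ?thesis
        by (subst Ck_on_cong[OF U dir_deriv_Re_vec[where f = f, OF U Suc.prems]]) auto
    qed
    ultimately show ?case by simp
  qed
  then show ?thesis by (simp add: smooth_on_def)
qed

text \<open>The null condition makes the induced metric \<open>c z\<close> times the Euclidean one,
  and a common zero of the derivatives is the only obstruction to \<open>c z > 0\<close>. For such a
  metric the numerator of the mean curvature is \<open>c z\<close> times the trace of the second
  form, which vanishes because the coordinates are harmonic.\<close>

lemma conformal_minimal_immersion_on_Re_vec:
  fixes f :: "3 \<Rightarrow> complex \<Rightarrow> complex"
  assumes U: "open U" and holo: "\<And>i. f i holomorphic_on U"
    and null: "\<And>z. z \<in> U \<Longrightarrow> (\<Sum>i\<in>UNIV. (deriv (f i) z)\<^sup>2) = 0"
    and nz: "\<And>z. z \<in> U \<Longrightarrow> \<exists>i. deriv (f i) z \<noteq> 0"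
  shows "conformal_minimal_immersion_on U (\<lambda>z. \<chi> i. Re (f i z))"
proof -
  define X where "X = (\<lambda>z. \<chi> i. Re (f i z))"
  define c where "c z = (\<Sum>i\<in>UNIV. (cmod (deriv (f i) z))\<^sup>2) / 2" for z
  have cpos: "c z > 0" if z: "z \<in> U" for z
  proof -
    obtain i where "deriv (f i) z \<noteq> 0" using nz[OF z] by blast
    then have "(\<Sum>i\<in>UNIV. (cmod (deriv (f i) z))\<^sup>2) > 0"
      by (intro sum_pos2[of _ i]) auto
    then show ?thesis by (simp add: c_def)
  qed
  have ff: "first_form X z v w = c z * (v \<bullet> w)" if z: "z \<in> U" for z v w
  proof -
    \<comment> \<open>This is Re x Re y = (Re (x y) + Re (x cnj y)) / 2 for x =
      \<open>d * v\<close>, y = \<open>d * w\<close>. Summed over the coordinates, the first term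
      dies by the null condition.\<close>
    have re: "Re (d * v) * Re (d * w) = (Re (d\<^sup>2 * (v * w)) + (cmod d)\<^sup>2 * (v \<bullet> w)) / 2" for d
      by (simp only: cmod_power2 inner_complex_def) (simp add: power2_eq_square algebra_simps)
    have "first_form X z v w = (\<Sum>i\<in>UNIV. Re (deriv (f i) z * v) * Re (deriv (f i) z * w))"
      unfolding first_form_def X_def dir_deriv_Re_vec[where f = f, OF U holo z] inner_vec_def by simp
    also have "\<dots> = (Re ((\<Sum>i\<in>UNIV. (deriv (f i) z)\<^sup>2) * (v * w)) + 2 * c z * (v \<bullet> w)) / 2"
      unfolding re c_def
      by (simp add: sum.distrib sum_distrib_right flip: sum_divide_distrib)
    finally show ?thesis using null[OF z] by simp
  qed
  have inj: "inj (frechet_derivative X (at z))" if z: "z \<in> U" for z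
  proof -
    let ?D = "frechet_derivative X (at z)"
    have "linear ?D"
      unfolding X_def frechet_derivative_Re_vec[where f = f, OF U holo z]
      by (rule has_derivative_linear[OF has_derivative_Re_vec_holomorphic[where f = f, OF U holo z]])
    moreover have "v = 0" if "?D v = 0" for v
      using ff[OF z, of v v] that cpos[OF z] by (simp add: first_form_def dir_deriv_def)
    ultimately show ?thesis by (simp add: linear_injective_0)
  qed
  have mc: "mean_curvature X z = 0" if z: "z \<in> U" for z
  proof -
    have "dir_deriv v (dir_deriv w X) z = (\<chi> i. Re (deriv (deriv (f i)) z * w * v))" for v w
    proof -
      have "dir_deriv v (dir_deriv w X) z = dir_deriv v (\<lambda>z. \<chi> i. Re (deriv (f i) z * w)) z"
        unfolding X_def by (intro dir_deriv_cong[OF U z] dir_deriv_Re_vec[where f = f, OF U holo])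
      also have "\<dots> = (\<chi> i. Re (deriv (\<lambda>z. deriv (f i) z * w) z * v))"
        using U z holo by (intro dir_deriv_Re_vec[of U] holomorphic_intros) auto
      also have "\<dots> = (\<chi> i. Re (deriv (deriv (f i)) z * w * v))"
      proof -
        have "(deriv (f i) has_field_derivative deriv (deriv (f i)) z) (at z)" for i
          using U z holo by (intro holomorphic_derivI[of _ U] holomorphic_intros) auto
        then have "deriv (\<lambda>z. deriv (f i) z * w) z = deriv (deriv (f i)) z * w" for i
          by (intro DERIV_imp_deriv DERIV_cmult_right)
        then show ?thesis by simp
      qed
      finally show ?thesis .
    qed
    \<comment> \<open>The product \<open>w * v\<close> is -1 for the pair \<i>, \<i> and 1 for the
      pair 1, 1.\<close>
    then have "second_form X z \<i> \<i> = - second_form X z 1 1"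
      by (simp add: second_form_def inner_vec_def sum_negf mult.assoc)
    then show ?thesis
      by (simp add: mean_curvature_def ff[OF z])
  qed
  have "smooth_on U X"
    unfolding X_def by (rule smooth_on_Re_vec[where f = f, OF U holo])
  then show ?thesis
    unfolding conformal_minimal_immersion_on_def immersion_on_def conformal_on_def
    unfolding X_def[symmetric]
    using inj mc ff cpos by meson
qed

section \<open>Uniform approximation and pole pushing\<close>

text \<open>\<open>K\<close> need not be compact, so boundedness is demanded separately; with it the
  approximable functions form an algebra closed under uniform limits.\<close>

definition approximable :: "complex set \<Rightarrow> complex set \<Rightarrow> (complex \<Rightarrow> complex) \<Rightarrow> bool" where
  "approximable V K f \<longleftrightarrow>
    bounded (f ` K) \<and> (\<forall>e>0. \<exists>F. F holomorphic_on V \<and> (\<forall>z\<in>K. cmod (F z - f z) \<le> e))"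

lemma approximable_holomorphic:
  assumes "f holomorphic_on V" "bounded (f ` K)"
  shows "approximable V K f"
  unfolding approximable_def using assms by (intro conjI allI impI exI[of _ f]) auto

lemma approximable_const: "approximable V K (\<lambda>_. c)"
  by (rule approximable_holomorphic) (auto intro!: finite_imp_bounded finite_subset[of _ "{c}"])

lemma approximable_add:
  assumes "approximable V K f" "approximable V K g"
  shows "approximable V K (\<lambda>z. f z + g z)"
  unfolding approximable_def
proof (intro conjI allI impI)
  show "bounded ((\<lambda>z. f z + g z) ` K)"
    using assms by (intro bounded_plus_comp) (auto simp: approximable_def)
next
  fix e :: real assume "e > 0"
  then obtain F G where "F holomorphic_on V" "\<And>z. z \<in> K \<Longrightarrow> cmod (F z - f z) \<le> e/2"
    "G holomorphic_on V" "\<And>z. z \<in> K \<Longrightarrow> cmod (G z - g z) \<le> e/2"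
    using assms unfolding approximable_def by (meson half_gt_zero)
  note FG = this
  have "cmod (F z + G z - (f z + g z)) \<le> e" if "z \<in> K" for z
    using FG(2,4)[OF that] norm_triangle_ineq[of "F z - f z" "G z - g z"] by (simp add: add_diff_add)
  then show "\<exists>H. H holomorphic_on V \<and> (\<forall>z\<in>K. cmod (H z - (f z + g z)) \<le> e)"
    using FG(1,3) by (intro exI[of _ "\<lambda>z. F z + G z"] conjI holomorphic_intros ballI)
qed

lemma approximable_mult:
  assumes "approximable V K f" "approximable V K g"
  shows "approximable V K (\<lambda>z. f z * g z)"
proof -
  obtain A where A: "A > 0" "\<And>z. z \<in> K \<Longrightarrow> cmod (f z) \<le> A"
    using assms(1) unfolding approximable_def bounded_pos by auto
  obtain B where B: "B > 0" "\<And>z. z \<in> K \<Longrightarrow> cmod (g z) \<le> B"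
    using assms(2) unfolding approximable_def bounded_pos by auto
  show ?thesis
    unfolding approximable_def
  proof (intro conjI allI impI)
    show "bounded ((\<lambda>z. f z * g z) ` K)"
      using A B unfolding bounded_pos
      by (intro exI[of _ "A * B"]) (auto simp: norm_mult intro: mult_mono)
  next
    fix e :: real assume e: "e > 0"
    \<comment> \<open>The bound \<open>d1 \<le> 1\<close> keeps \<open>F\<close> below
      \<open>A + 1\<close>; then each of the two terms of the product error contributes at most
      \<open>e / 2\<close>.\<close>
    define d1 where "d1 = min 1 (e / (2 * B))"
    define d2 where "d2 = e / (2 * (A + 1))"
    have d: "d1 > 0" "d2 > 0" "d1 \<le> 1" "d1 * B \<le> e / 2" "(A + 1) * d2 = e / 2"
      using A(1) B(1) e by (auto simp: d1_def d2_def field_simps min_def)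
    obtain F where F: "F holomorphic_on V" "\<And>z. z \<in> K \<Longrightarrow> cmod (F z - f z) \<le> d1"
      using assms(1) d(1) unfolding approximable_def by meson
    obtain G where G: "G holomorphic_on V" "\<And>z. z \<in> K \<Longrightarrow> cmod (G z - g z) \<le> d2"
      using assms(2) d(2) unfolding approximable_def by meson
    have "cmod (F z * G z - f z * g z) \<le> e" if z: "z \<in> K" for z
    proof -
      have "cmod (F z) \<le> A + 1"
        using F(2)[OF z] A(2)[OF z] d(3) norm_triangle_sub[of "F z" "f z"] by linarith
      then have "cmod (F z * (G z - g z)) \<le> (A + 1) * d2"
        using G(2)[OF z] A(1) unfolding norm_mult by (intro mult_mono) auto
      moreover have "cmod ((F z - f z) * g z) \<le> d1 * B"
        using F(2)[OF z] B(2)[OF z] d(1) unfolding norm_mult by (intro mult_mono) auto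
      moreover have "F z * G z - f z * g z = F z * (G z - g z) + (F z - f z) * g z"
        by (simp add: algebra_simps)
      ultimately show ?thesis
        using norm_triangle_ineq[of "F z * (G z - g z)" "(F z - f z) * g z"] d(4,5) by simp
    qed
    then show "\<exists>H. H holomorphic_on V \<and> (\<forall>z\<in>K. cmod (H z - f z * g z) \<le> e)"
      using F(1) G(1) by (intro exI[of _ "\<lambda>z. F z * G z"] conjI holomorphic_intros ballI)
  qed
qed

lemma approximable_power:
  assumes "approximable V K f"
  shows "approximable V K (\<lambda>z. f z ^ n)"
  by (induction n) (auto intro: approximable_const approximable_mult assms)

lemma approximable_sum:
  assumes "\<And>i. i \<in> I \<Longrightarrow> approximable V K (f i)"
  shows "approximable V K (\<lambda>z. \<Sum>i\<in>I. f i z)"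
  using assms
  by (induction I rule: infinite_finite_induct) (auto intro: approximable_const approximable_add)

lemma approximable_uniform_limit:
  assumes "\<And>e. e > 0 \<Longrightarrow> \<exists>g. approximable V K g \<and> (\<forall>z\<in>K. cmod (g z - f z) \<le> e)"
  shows "approximable V K f"
  unfolding approximable_def
proof (intro conjI allI impI)
  obtain g where g: "approximable V K g" "\<And>z. z \<in> K \<Longrightarrow> cmod (g z - f z) \<le> 1"
    using assms[of 1] by auto
  obtain A where A: "\<And>z. z \<in> K \<Longrightarrow> cmod (g z) \<le> A"
    using g(1) unfolding approximable_def bounded_iff by auto
  have "cmod (f z) \<le> A + 1" if "z \<in> K" for z
    using A[OF that] g(2)[OF that] norm_triangle_sub[of "f z" "g z"]
    by (simp add: norm_minus_commute)
  then show "bounded (f ` K)"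
    unfolding bounded_iff by auto
next
  fix e :: real assume e: "e > 0"
  obtain g where g: "approximable V K g" "\<And>z. z \<in> K \<Longrightarrow> cmod (g z - f z) \<le> e/2"
    using assms[of "e/2"] e by auto
  obtain F where F: "F holomorphic_on V" "\<And>z. z \<in> K \<Longrightarrow> cmod (F z - g z) \<le> e/2"
    using g(1) e unfolding approximable_def by (meson half_gt_zero)
  have "cmod (F z - f z) \<le> e" if "z \<in> K" for z
    using F(2)[OF that] g(2)[OF that] norm_triangle_ineq[of "F z - g z" "g z - f z"] by simp
  with F(1) show "\<exists>F. F holomorphic_on V \<and> (\<forall>z\<in>K. cmod (F z - f z) \<le> e)"
    by blast
qed

text \<open>The geometric expansion of \<open>1 / (z - p)\<close> in powers of
  \<open>(p - p') / (z - p')\<close> converges uniformly on \<open>K\<close>, the ratio being at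
  most 1/2, and its partial sums are polynomials in \<open>1 / (z - p')\<close>.\<close>

lemma approximable_inverse_near:
  assumes d: "d > 0" and far: "\<And>z. z \<in> K \<Longrightarrow> d \<le> cmod (z - p')"
    and near: "cmod (p - p') \<le> d / 2"
    and appr: "approximable V K (\<lambda>z. 1 / (z - p'))"
  shows "approximable V K (\<lambda>z. 1 / (z - p))"
proof (rule approximable_uniform_limit)
  fix e :: real assume e: "e > 0"
  \<comment> \<open>The error after \<open>n\<close> terms is
    \<open>cmod r ^ n / cmod (z - p)\<close>, and \<open>z\<close> stays at distance at least
    \<open>d / 2\<close> from \<open>p\<close>.\<close>
  obtain n where n: "(1/2::real) ^ n < e * d / 2"
    using real_arch_pow_inv[of "e * d / 2" "1/2"] d e by auto
  define T where "T z = 1 / (z - p') * (\<Sum>j<n. ((p - p') * (1 / (z - p'))) ^ j)" for z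
  have "approximable V K T"
    unfolding T_def
    by (intro approximable_mult approximable_sum approximable_power approximable_const appr)
  moreover have "cmod (T z - 1 / (z - p)) \<le> e" if z: "z \<in> K" for z
  proof -
    define r where "r = (p - p') / (z - p')"
    have zp': "cmod (z - p') \<ge> d" "z \<noteq> p'"
      using far[OF z] d by auto
    have r: "cmod r \<le> 1/2"
      using near zp' d by (auto simp: r_def norm_divide field_simps)
    then have r1: "r \<noteq> 1" by auto
    have zp: "cmod (z - p) \<ge> d / 2"
      using zp' near norm_triangle_ineq2[of "z - p'" "p - p'"] by simp
    have eq: "1 / (z - p) = 1 / (z - p') * (1 / (1 - r))"
      using zp' zp d by (auto simp: r_def field_simps)
    have "T z = 1 / (z - p') * (\<Sum>j<n. r ^ j)"
      by (simp add: T_def r_def)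
    also have "\<dots> = 1 / (z - p') * ((1 - r ^ n) / (1 - r))"
      using r1 by (simp add: sum_gp_strict)
    also have "\<dots> = 1 / (z - p) - r ^ n * (1 / (z - p))"
      unfolding eq by (simp add: diff_divide_distrib right_diff_distrib)
    finally have "cmod (T z - 1 / (z - p)) = cmod r ^ n / cmod (z - p)"
      by (simp add: norm_mult norm_power norm_divide)
    also have "\<dots> \<le> (1/2) ^ n / (d / 2)"
      using r zp d by (intro frac_le power_mono) auto
    also have "\<dots> \<le> e"
      using n d by (simp add: field_simps)
    finally show ?thesis .
  qed
  ultimately show "\<exists>g. approximable V K g \<and> (\<forall>z\<in>K. cmod (g z - 1 / (z - p)) \<le> e)"
    by blast
qed

text \<open>At the far end of the segment the pole lies outside \<open>V\<close>, where the function
  is itself holomorphic on \<open>V\<close>. From there the pole is moved back to \<open>p\<close>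
  in steps of length at most \<open>d / 2\<close>; the induction counts these steps.\<close>

lemma approximable_inverse_along_ray:
  assumes d: "d > 0" and u: "cmod u = 1" and T: "T \<ge> 0" "p + of_real T * u \<notin> V"
    and far: "\<And>t z. t \<ge> 0 \<Longrightarrow> z \<in> K \<Longrightarrow> d \<le> cmod (z - (p + of_real t * u))"
  shows "approximable V K (\<lambda>z. 1 / (z - p))"
proof -
  have *: "approximable V K (\<lambda>z. 1 / (z - (p + of_real t * u)))"
    if "0 \<le> t" "t \<le> T" "T - t \<le> real n * (d / 2)" for t n
    using that
  proof (induction n arbitrary: t)
    case 0
    then have t: "t = T" by simp
    show ?case unfolding t
    proof (rule approximable_holomorphic)
      show "(\<lambda>z. 1 / (z - (p + of_real T * u))) holomorphic_on V"
        using T by (intro holomorphic_intros) auto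
      have "cmod (1 / (z - (p + of_real T * u))) \<le> 1 / d" if "z \<in> K" for z
        using far[OF T(1) that] d by (simp add: norm_divide frac_le)
      then show "bounded ((\<lambda>z. 1 / (z - (p + of_real T * u))) ` K)"
        unfolding bounded_iff by blast
    qed
  next
    case (Suc n)
    define t' where "t' = min T (t + d / 2)"
    have t': "0 \<le> t'" "t' \<le> T" "T - t' \<le> real n * (d / 2)" "\<bar>t - t'\<bar> \<le> d / 2"
      using Suc.prems d by (auto simp: t'_def min_def algebra_simps)
    have "cmod ((p + of_real t * u) - (p + of_real t' * u)) = \<bar>t - t'\<bar>"
      using u by (simp add: norm_mult flip: left_diff_distrib of_real_diff)
    with t' show ?case
      by (intro approximable_inverse_near[OF d far[OF t'(1)] _ Suc.IH[OF t'(1-3)]]) auto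
  qed
  obtain n where "T \<le> real n * (d / 2)"
    using d reals_Archimedean3[of "d/2"] by (metis half_gt_zero less_imp_le)
  then show ?thesis
    using *[of 0 n] T(1) by simp
qed

text \<open>Roots are split off one at a time, so the reciprocal is a product of simple poles and a
  constant.\<close>

lemma approximable_inverse_poly:
  assumes "q \<noteq> 0" "\<And>r. poly q r = 0 \<Longrightarrow> approximable V K (\<lambda>z. 1 / (z - r))"
  shows "approximable V K (\<lambda>z. 1 / poly q z)"
  using assms
proof (induction "degree q" arbitrary: q)
  case 0
  then obtain c where "q = [:c:]"
    by (metis degree_eq_zeroE)
  then show ?case
    by (simp add: approximable_const)
next
  case (Suc n)
  then have "\<not> constant (poly q)" by (simp add: constant_degree)
  then obtain r where r: "poly q r = 0"
    using fundamental_theorem_of_algebra by blast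
  then obtain q' where q': "q = [:- r, 1:] * q'"
    by (metis dvd_def poly_eq_0_iff_dvd)
  then have nz: "q' \<noteq> 0" using Suc.prems by auto
  have "degree q = Suc (degree q')"
    unfolding q' using nz by (subst degree_mult_eq) auto
  then have "approximable V K (\<lambda>z. 1 / poly q' z)"
    using Suc nz q' by (intro Suc.hyps(1)) auto
  then have "approximable V K (\<lambda>z. 1 / (z - r) * (1 / poly q' z))"
    using Suc.prems(2)[OF r] by (rule approximable_mult[rotated])
  then show ?case
    by (simp add: q' left_diff_distrib)
qed

section \<open>Step functions\<close>

text \<open>
  All poles lie on the circle \<open>\<bar>p + \<i> R\<bar> = \<rho>\<close>, whose part with \<open>\<bar>Re p\<bar> < 3\<close> and \<open>Im p \<ge> 0\<close> runs
  inside the strip \<open>a < Im p < b\<close> and meets the imaginary axis in no pole. So each pole can be pushed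
  horizontally, away from the axis.
\<close>

lemma approximable_circle_step:
  fixes R \<rho> :: real
  assumes \<rho>: "\<rho> > 0" and N: "N > 0" and ab: "0 < a" "a < b" "R > 0"
    and inside: "9 + (R + a)\<^sup>2 < \<rho>\<^sup>2" and outside: "\<rho> < R + b"
  shows "approximable {z. \<bar>Re z\<bar> < 3}
     ({z. \<bar>Re z\<bar> < 2 \<and> (0 \<le> Im z \<and> Im z \<le> a \<or> b \<le> Im z)} \<union> {z. Re z = 0 \<and> 0 \<le> Im z})
     (\<lambda>z. 1 / (1 + ((z + \<i> * of_real R) / (\<i> * of_real \<rho>)) ^ N))"
    (is "approximable ?V ?K ?f")
proof -
  define q :: "complex poly" where
    "q = 1 + [: of_real R / of_real \<rho>, 1 / (\<i> * of_real \<rho>) :] ^ N"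
  have q: "poly q z = 1 + ((z + \<i> * of_real R) / (\<i> * of_real \<rho>)) ^ N" for z
    using \<rho> by (simp add: q_def add_divide_distrib add.commute)
  have "approximable ?V ?K (\<lambda>z. 1 / poly q z)"
  proof (rule approximable_inverse_poly)
    have "poly q (- \<i> * of_real R) = 1"
      using N by (simp add: q)
    then show "q \<noteq> 0" by auto
  next
    fix p assume "poly q p = 0"
    then have root: "((p + \<i> * of_real R) / (\<i> * of_real \<rho>)) ^ N = -1"
      by (simp add: q eq_neg_iff_add_eq_0 add.commute)
    then have "cmod ((p + \<i> * of_real R) / (\<i> * of_real \<rho>)) ^ N = 1"
      by (metis norm_minus_cancel norm_one norm_power)
    then have "cmod ((p + \<i> * of_real R) / (\<i> * of_real \<rho>)) = 1"
      using N by (intro power_eq_imp_eq_base[of _ N 1]) (simp_all del: norm_divide)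
    then have "cmod (p + \<i> * of_real R) = \<rho>"
      using \<rho> by (simp add: norm_divide norm_mult)
    then have circ: "(Re p)\<^sup>2 + (Im p + R)\<^sup>2 = \<rho>\<^sup>2"
      by (auto simp: cmod_def)
    have K0: "Im z \<ge> 0" if "z \<in> ?K" for z
      using that ab by auto
    show "approximable ?V ?K (\<lambda>z. 1 / (z - p))"
    \<comment> \<open>A pole below the real axis can be pushed to the right beneath
      \<open>?K\<close>; one with \<open>\<bar>Re p\<bar> \<ge> 3\<close> already lies outside
      \<open>?V\<close>.\<close>
    proof (cases "Im p < 0 \<or> \<bar>Re p\<bar> \<ge> 3")
      case True
      show ?thesis
      proof (cases "Im p < 0")
        case True
        have "- Im p \<le> cmod (z - (p + of_real t * 1))" if "z \<in> ?K" for z t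
          using K0[OF that] abs_Im_le_cmod[of "z - (p + of_real t * 1)"] by simp
        then show ?thesis
          using True by (intro approximable_inverse_along_ray[of "- Im p" 1 "\<bar>Re p\<bar> + 3"]) auto
      next
        case False
        then have Re: "\<bar>Re p\<bar> \<ge> 3" using True by auto
        show ?thesis
        proof (rule approximable_holomorphic)
          show "(\<lambda>z. 1 / (z - p)) holomorphic_on ?V"
            using Re by (intro holomorphic_intros) auto
          have "cmod (1 / (z - p)) \<le> 1" if "z \<in> ?K" for z
          proof -
            have "1 \<le> \<bar>Re (z - p)\<bar>"
              using that Re by auto
            then have "1 \<le> cmod (z - p)"
              using abs_Re_le_cmod[of "z - p"] by linarith
            then show ?thesis
              using frac_le[of 1 1 1 "cmod (z - p)"] by (simp add: norm_divide)
          qed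
          then show "bounded ((\<lambda>z. 1 / (z - p)) ` ?K)"
            unfolding bounded_iff by blast
        qed
      qed
    next
      case False
      then have Im0: "Im p \<ge> 0" and Re2: "\<bar>Re p\<bar> < 3" by auto
      have Re2': "(Re p)\<^sup>2 < 9"
        using Re2 power_strict_mono[of "\<bar>Re p\<bar>" 3 2] by simp
      have "a < Im p"
      proof (rule ccontr)
        assume "\<not> a < Im p"
        then have "(Im p + R)\<^sup>2 \<le> (R + a)\<^sup>2"
          using Im0 ab by (intro power_mono) auto
        then show False using circ inside Re2' by linarith
      qed
      have "Im p < b"
      proof (rule ccontr)
        assume "\<not> Im p < b"
        then have "\<rho>\<^sup>2 < (Im p + R)\<^sup>2"
          using \<rho> outside by (intro power_strict_mono) auto
        then show False using circ zero_le_power2[of "Re p"] by linarith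
      qed
      \<comment> \<open>On the upper imaginary axis the base of the power is a nonnegative real,
        whose \<open>N\<close>-th power cannot be -1.\<close>
      have "Re p \<noteq> 0"
      proof
        assume "Re p = 0"
        then have "p + \<i> * of_real R = \<i> * of_real (Im p + R)"
          by (simp add: complex_eq_iff)
        then have "(p + \<i> * of_real R) / (\<i> * of_real \<rho>) = of_real ((Im p + R) / \<rho>)"
          by simp
        then have "of_real (((Im p + R) / \<rho>) ^ N) = (of_real (-1) :: complex)"
          using root by simp
        then have "((Im p + R) / \<rho>) ^ N = -1"
          using of_real_eq_iff by blast
        moreover have "((Im p + R) / \<rho>) ^ N \<ge> 0"
          using Im0 ab \<rho> by simp
        ultimately show False by simp
      qed
      \<comment> \<open>Moving away from the axis keeps the distance \<open>\<bar>Re p\<bar>\<close>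
        to the axis part of \<open>?K\<close>; the rest of \<open>?K\<close> is separated vertically
        by the lines \<open>Im z = a\<close> and \<open>Im z = b\<close>.\<close>
      define d where "d = min \<bar>Re p\<bar> (min (Im p - a) (b - Im p))"
      have d: "d > 0" "d \<le> \<bar>Re p\<bar>" "d \<le> Im p - a" "d \<le> b - Im p"
        using \<open>Re p \<noteq> 0\<close> \<open>a < Im p\<close> \<open>Im p < b\<close> by (auto simp: d_def)
      have "d \<le> cmod (z - (p + of_real t * of_real (sgn (Re p))))" if "z \<in> ?K" "t \<ge> 0" for z t
      proof -
        let ?w = "z - (p + of_real t * of_real (sgn (Re p)))"
        have "d \<le> \<bar>Re ?w\<bar> \<or> d \<le> \<bar>Im ?w\<bar>"
          using that d by (auto simp: sgn_if)
        then show ?thesis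
          using abs_Re_le_cmod[of ?w] abs_Im_le_cmod[of ?w] by linarith
      qed
      then show ?thesis
        using d(1) \<open>Re p \<noteq> 0\<close>
        by (intro approximable_inverse_along_ray[of d "of_real (sgn (Re p))" 3]) (auto simp: sgn_if)
    qed
  qed
  then show ?thesis by (simp add: q)
qed


text \<open>
  The last clause controls \<open>G\<close> across the strip \<open>a < Im z < b\<close>, though only on the imaginary axis;
  this suffices to estimate integrals along the axis.
\<close>

lemma exists_step_function:
  assumes ab: "0 < a" "a < b" and e: "e > 0"
  shows "\<exists>G. G holomorphic_on {z. \<bar>Re z\<bar> < 2} \<and>
     (\<forall>z. \<bar>Re z\<bar> < 2 \<longrightarrow> 0 \<le> Im z \<longrightarrow> Im z \<le> a \<longrightarrow> cmod (G z - 1) \<le> e) \<and>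
     (\<forall>z. \<bar>Re z\<bar> < 2 \<longrightarrow> b \<le> Im z \<longrightarrow> cmod (G z) \<le> e) \<and>
     (\<forall>z. Re z = 0 \<longrightarrow> 0 \<le> Im z \<longrightarrow> (\<exists>s\<in>{0..1}. cmod (G z - of_real s) \<le> e))"
proof -
  \<comment> \<open>The upper arc of a large circle is nearly a horizontal line.\<close>
  define R where "R = 5 / (b - a)"
  have R: "R > 0" "2 * R * (b - a) = 10"
    using ab nonzero_mult_divide_mult_cancel_right[of "b - a" 10 1] by (auto simp: R_def)
  \<comment> \<open>The surplus \<open>2 * R * (b - a) = 10\<close> exceeds 9, the square of the
    half-width 3 of the strip of holomorphy, which leaves room for a radius in between.\<close>
  have "9 + (R + a)\<^sup>2 < (R + b)\<^sup>2"
  proof -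
    have "(R + b)\<^sup>2 = (R + a)\<^sup>2 + 2 * R * (b - a) + (b\<^sup>2 - a\<^sup>2)"
      by (simp add: power2_eq_square algebra_simps)
    moreover have "a\<^sup>2 < b\<^sup>2"
      using ab by (intro power_strict_mono) auto
    ultimately show ?thesis using R(2) by linarith
  qed
  then obtain m where m: "9 + (R + a)\<^sup>2 < m" "m < (R + b)\<^sup>2"
    using dense by blast
  define \<rho> where "\<rho> = sqrt m"
  have "m > 0" using m(1) zero_le_power2[of "R + a"] by linarith
  then have \<rho>: "\<rho> > 0" "9 + (R + a)\<^sup>2 < \<rho>\<^sup>2" "\<rho> < R + b"
    using m R ab by (auto simp: \<rho>_def real_less_lsqrt)
  \<comment> \<open>One ratio bounds \<open>cmod (\<sigma> z)\<close> on the lower part, the other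
    bounds its reciprocal on the upper part.\<close>
  define q where "q = max (sqrt (4 + (R + a)\<^sup>2) / \<rho>) (\<rho> / (R + b))"
  have "sqrt (4 + (R + a)\<^sup>2) < \<rho>"
    using \<rho> by (intro real_less_lsqrt) auto
  then have q: "0 < q" "q < 1"
    using \<rho> R ab by (auto simp: q_def less_max_iff_disj)
  obtain N0 where N0: "q ^ N0 < min (1/2) (e / 4)"
    using real_arch_pow_inv[of "min (1/2) (e / 4)" q] q e by auto
  define N where "N = Suc N0"
  have N: "N > 0" "q ^ N \<le> 1/2" "2 * q ^ N \<le> e / 2"
  proof -
    have "q ^ N \<le> q ^ N0"
      using q by (intro power_decreasing) (auto simp: N_def)
    then show "q ^ N \<le> 1/2" "2 * q ^ N \<le> e / 2"
      using N0 by auto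
  qed (simp add: N_def)
  define \<sigma> where "\<sigma> z = (z + \<i> * of_real R) / (\<i> * of_real \<rho>)" for z
  \<comment> \<open>For large \<open>N\<close> this is close to 1 inside the circle and close to 0
    outside. On the upper imaginary axis \<open>\<sigma> z\<close> is real and nonnegative, so
    \<open>r z\<close> is real and between 0 and 1.\<close>
  define r where "r z = 1 / (1 + \<sigma> z ^ N)" for z
  define V where "V = {z. \<bar>Re z\<bar> < 3}"
  define K where "K = {z. \<bar>Re z\<bar> < 2 \<and> (0 \<le> Im z \<and> Im z \<le> a \<or> b \<le> Im z)} \<union> {z. Re z = 0 \<and> 0 \<le> Im z}"
  have "approximable V K r"
    unfolding V_def K_def r_def \<sigma>_def using \<rho> N ab R
    by (intro approximable_circle_step) auto
  then obtain G where G: "G holomorphic_on V" "\<And>z. z \<in> K \<Longrightarrow> cmod (G z - r z) \<le> e / 2"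
    using e unfolding approximable_def by (meson half_gt_zero)
  have \<sigma>: "cmod (\<sigma> z) = sqrt ((Re z)\<^sup>2 + (Im z + R)\<^sup>2) / \<rho>" for z
  proof -
    have "cmod (z + \<i> * of_real R) = sqrt ((Re z)\<^sup>2 + (Im z + R)\<^sup>2)"
      by (simp add: cmod_def)
    then show ?thesis
      using \<rho> by (simp add: \<sigma>_def norm_divide norm_mult)
  qed
  have below: "cmod (r z - 1) \<le> e / 2" if z: "\<bar>Re z\<bar> < 2" "0 \<le> Im z" "Im z \<le> a" for z
  proof -
    have "(Re z)\<^sup>2 \<le> 2\<^sup>2" "(Im z + R)\<^sup>2 \<le> (R + a)\<^sup>2"
      using z R power_mono[of "\<bar>Re z\<bar>" 2 2] by (auto intro!: power_mono)
    then have "cmod (\<sigma> z) \<le> sqrt (4 + (R + a)\<^sup>2) / \<rho>"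
      unfolding \<sigma> using \<rho> by (intro divide_right_mono real_sqrt_le_mono) auto
    then have "cmod (\<sigma> z) \<le> q"
      by (simp add: q_def)
    then have sN: "cmod (\<sigma> z ^ N) \<le> q ^ N"
      unfolding norm_power by (intro power_mono) auto
    then have den: "cmod (1 + \<sigma> z ^ N) \<ge> 1/2"
      using N(2) norm_triangle_ineq2[of 1 "- (\<sigma> z ^ N)"] by simp
    then have "1 + \<sigma> z ^ N \<noteq> 0" by auto
    then have "r z - 1 = - (\<sigma> z ^ N) / (1 + \<sigma> z ^ N)"
      by (simp add: r_def field_simps)
    then have "cmod (r z - 1) \<le> q ^ N / (1/2)"
      using sN den q by (simp only: norm_divide norm_minus_cancel) (intro frac_le; simp)
    then show ?thesis using N(3) by simp
  qed
  have above: "cmod (r z) \<le> e / 2" if z: "b \<le> Im z" for z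
  proof -
    have "(R + b)\<^sup>2 \<le> (Im z + R)\<^sup>2"
      using z ab R by (intro power_mono) auto
    then have "R + b \<le> sqrt ((Re z)\<^sup>2 + (Im z + R)\<^sup>2)"
      by (intro real_le_rsqrt) (simp add: add_increasing)
    then have "(R + b) / \<rho> \<le> cmod (\<sigma> z)"
      unfolding \<sigma> using \<rho> by (intro divide_right_mono) auto
    moreover have "1 / q \<le> (R + b) / \<rho>"
    proof -
      have "\<rho> / (R + b) \<le> q" by (simp add: q_def)
      then have "1 / q \<le> 1 / (\<rho> / (R + b))"
        using \<rho> R ab by (intro frac_le) auto
      then show ?thesis by simp
    qed
    ultimately have "1 / q \<le> cmod (\<sigma> z)" by linarith
    then have sN: "1 / q ^ N \<le> cmod (\<sigma> z ^ N)"
      using q unfolding norm_power power_one_over[symmetric] by (intro power_mono) auto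
    have "2 \<le> 1 / q ^ N"
      using N(2) q by (simp add: field_simps)
    then have half: "1 / q ^ N / 2 \<le> 1 / q ^ N - 1" by simp
    have "1 / q ^ N / 2 \<le> cmod (1 + \<sigma> z ^ N)"
      using sN half norm_triangle_ineq2[of "\<sigma> z ^ N" "-1"] by (simp add: add.commute)
    then have "cmod (r z) \<le> 1 / (1 / q ^ N / 2)"
      using q unfolding r_def norm_divide by (intro frac_le) auto
    then show ?thesis using N(3) by simp
  qed
  have axis: "\<exists>s\<in>{0..1}. r z = of_real s" if z: "Re z = 0" "0 \<le> Im z" for z
  proof -
    have "z + \<i> * of_real R = \<i> * of_real (Im z + R)"
      using z by (simp add: complex_eq_iff)
    then have "\<sigma> z = of_real ((Im z + R) / \<rho>)"
      by (simp add: \<sigma>_def)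
    then have "r z = of_real (1 / (1 + ((Im z + R) / \<rho>) ^ N))"
      by (simp add: r_def)
    moreover have "1 / (1 + ((Im z + R) / \<rho>) ^ N) \<in> {0..1}"
    proof -
      have "0 \<le> ((Im z + R) / \<rho>) ^ N"
        using \<rho> z R by (intro zero_le_power divide_nonneg_pos) auto
      then have "0 \<le> 1 / (1 + t) \<and> 1 / (1 + t) \<le> 1" if "t = ((Im z + R) / \<rho>) ^ N" for t
        using that by simp
      then show ?thesis by (simp del: power_divide)
    qed
    ultimately show ?thesis by blast
  qed
  show ?thesis
  proof (intro exI[of _ G] conjI allI impI)
    show "G holomorphic_on {z. \<bar>Re z\<bar> < 2}"
      by (rule holomorphic_on_subset[OF G(1)]) (auto simp: V_def)
  next
    fix z assume z: "\<bar>Re z\<bar> < 2" "0 \<le> Im z" "Im z \<le> a"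
    then have "z \<in> K" by (simp add: K_def)
    then show "cmod (G z - 1) \<le> e"
      using G(2)[of z] below[OF z] norm_triangle_ineq[of "G z - r z" "r z - 1"] by simp
  next
    fix z assume z: "\<bar>Re z\<bar> < 2" "b \<le> Im z"
    then have "z \<in> K" by (simp add: K_def)
    then show "cmod (G z) \<le> e"
      using G(2)[of z] above[OF z(2)] norm_triangle_ineq[of "G z - r z" "r z"] by simp
  next
    fix z assume z: "Re z = 0" "0 \<le> Im z"
    then have "z \<in> K" by (simp add: K_def)
    then have "cmod (G z - r z) \<le> e"
      using G(2)[of z] e by simp
    with axis[OF z] show "\<exists>s\<in>{0..1}. cmod (G z - of_real s) \<le> e"
      by metis
  qed
qed

section \<open>Bumps and series of steps\<close>

text \<open>The bump is the difference of two steps, one falling between \<open>q\<close> and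
  \<open>b\<close>, the other between \<open>a\<close> and \<open>p\<close>.\<close>

lemma exists_bump_function:
  assumes ab: "0 < a" "a < p" "p \<le> q" "q < b" and e: "e > 0"
  shows "\<exists>B. B holomorphic_on {z. \<bar>Re z\<bar> < 2} \<and>
     (\<forall>z. \<bar>Re z\<bar> < 2 \<longrightarrow> 0 \<le> Im z \<longrightarrow> Im z \<le> a \<or> b \<le> Im z \<longrightarrow> cmod (B z) \<le> e) \<and>
     (\<forall>z. \<bar>Re z\<bar> < 2 \<longrightarrow> p \<le> Im z \<longrightarrow> Im z \<le> q \<longrightarrow> cmod (B z - 1) \<le> e) \<and>
     (\<forall>z. Re z = 0 \<longrightarrow> 0 \<le> Im z \<longrightarrow> (\<exists>s\<in>{0..1}. cmod (B z - of_real s) \<le> e))"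
proof -
  obtain G where G: "G holomorphic_on {z. \<bar>Re z\<bar> < 2}"
    "\<And>z. \<bar>Re z\<bar> < 2 \<Longrightarrow> 0 \<le> Im z \<Longrightarrow> Im z \<le> q \<Longrightarrow> cmod (G z - 1) \<le> e/2"
    "\<And>z. \<bar>Re z\<bar> < 2 \<Longrightarrow> b \<le> Im z \<Longrightarrow> cmod (G z) \<le> e/2"
    "\<And>z. Re z = 0 \<Longrightarrow> 0 \<le> Im z \<Longrightarrow> \<exists>s\<in>{0..1}. cmod (G z - of_real s) \<le> e/2"
    using exists_step_function[of q b "e/2"] ab e by auto
  obtain F where F: "F holomorphic_on {z. \<bar>Re z\<bar> < 2}"
    "\<And>z. \<bar>Re z\<bar> < 2 \<Longrightarrow> 0 \<le> Im z \<Longrightarrow> Im z \<le> a \<Longrightarrow> cmod (F z - 1) \<le> e/2"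
    "\<And>z. \<bar>Re z\<bar> < 2 \<Longrightarrow> p \<le> Im z \<Longrightarrow> cmod (F z) \<le> e/2"
    "\<And>z. Re z = 0 \<Longrightarrow> 0 \<le> Im z \<Longrightarrow> \<exists>s\<in>{0..1}. cmod (F z - of_real s) \<le> e/2"
    using exists_step_function[of a p "e/2"] ab e by auto
  have diff: "cmod (G z - F z - (x - y)) \<le> e" if "cmod (G z - x) \<le> e/2" "cmod (F z - y) \<le> e/2" for x y z
    using norm_triangle_ineq4[of "G z - x" "F z - y"] that by (simp add: algebra_simps)
  show ?thesis
  proof (intro exI[of _ "\<lambda>z. G z - F z"] conjI allI impI)
    show "(\<lambda>z. G z - F z) holomorphic_on {z. \<bar>Re z\<bar> < 2}"
      using G F by (intro holomorphic_intros)
  next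
    fix z assume "\<bar>Re z\<bar> < 2" "0 \<le> Im z" "Im z \<le> a \<or> b \<le> Im z"
    then show "cmod (G z - F z) \<le> e"
      using diff[of z 1 1] diff[of z 0 0] G(2,3)[of z] F(2,3)[of z] ab by auto
  next
    fix z assume "\<bar>Re z\<bar> < 2" "p \<le> Im z" "Im z \<le> q"
    then show "cmod (G z - F z - 1) \<le> e"
      using diff[of z 1 0] G(2)[of z] F(3)[of z] ab by auto
  next
    fix z assume z: "Re z = 0" "0 \<le> Im z"
    show "\<exists>s\<in>{0..1}. cmod (G z - F z - of_real s) \<le> e"
    \<comment> \<open>On either side of \<open>q\<close> one of the two steps is nearly constant:
      \<open>G\<close> is near 1 up to \<open>q\<close>, and \<open>F\<close> is near 0 above
      it.\<close>
    proof (cases "Im z \<le> q")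
      case True
      obtain s where "s \<in> {0..1}" "cmod (F z - of_real s) \<le> e/2"
        using F(4)[OF z] by blast
      then show ?thesis
        using diff[of z 1 "of_real s"] G(2)[of z] z True by (intro bexI[of _ "1 - s"]) auto
    next
      case False
      obtain s where "s \<in> {0..1}" "cmod (G z - of_real s) \<le> e/2"
        using G(4)[OF z] by blast
      then show ?thesis
        using diff[of z "of_real s" 0] F(3)[of z] z False ab by (intro bexI[of _ s]) auto
    qed
  qed
qed

section \<open>Series on an open convex neighbourhood of the rectangle\<close>

definition half_strip :: "complex set" where
  "half_strip = {z. \<bar>Re z\<bar> < 2 \<and> 0 < Im z}"

lemma open_half_strip: "open half_strip"
  unfolding half_strip_def by (intro open_Collect_conj open_Collect_less continuous_intros)

lemma convex_half_strip: "convex half_strip"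
proof -
  have eq: "half_strip = {z. - 2 < Re z} \<inter> {z. Re z < 2} \<inter> {z. 0 < Im z}"
    by (auto simp: half_strip_def)
  show ?thesis
    unfolding eq by (intro convex_Int convex_halfspace_Re_gt convex_halfspace_Re_lt convex_halfspace_Im_gt)
qed

text \<open>Near a fixed point all but finitely many terms obey the geometric bound, because
  \<open>\<beta> n\<close> drops below its height. No bound is imposed beneath
  \<open>\<beta> n\<close>, so the sum may grow without limit towards
  \<open>Im z = 0\<close>.\<close>

lemma holomorphic_series_half_strip:
  assumes holo: "\<And>n. F n holomorphic_on {z. \<bar>Re z\<bar> < 2}"
    and small: "\<And>n z. \<bar>Re z\<bar> < 2 \<Longrightarrow> \<beta> n \<le> Im z \<Longrightarrow> cmod (F n z) \<le> (1/2) ^ Suc n"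
    and \<beta>: "\<beta> \<longlonglongrightarrow> 0"
  obtains g where "g holomorphic_on half_strip" "\<And>z. z \<in> half_strip \<Longrightarrow> (\<lambda>n. F n z) sums g z"
proof -
  have "\<exists>g g'. \<forall>x\<in>half_strip. (\<lambda>n. F n x) sums g x \<and> (\<lambda>n. deriv (F n) x) sums g' x \<and>
      (g has_field_derivative g' x) (at x)"
  proof (rule series_and_derivative_comparison_local[OF open_half_strip])
    show "(F n has_field_derivative deriv (F n) x) (at x)" if "x \<in> half_strip" for n x
    proof (rule holomorphic_derivI[OF holo])
      show "open {z. \<bar>Re z\<bar> < 2}"
        by (intro open_Collect_less continuous_intros)
    qed (use that in \<open>auto simp: half_strip_def\<close>)
  next
    fix x assume x: "x \<in> half_strip"
    then have Im: "Im x > 0" by (simp add: half_strip_def)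
    have "\<forall>\<^sub>F n in sequentially. \<beta> n < Im x / 2"
      by (rule order_tendstoD(2)[OF \<beta>]) (use Im in simp)
    then have "\<forall>\<^sub>F n in sequentially. \<forall>y\<in>ball x (Im x / 2) \<inter> half_strip. cmod (F n y) \<le> (1/2) ^ Suc n"
    proof (rule eventually_mono, intro ballI)
      fix n y assume n: "\<beta> n < Im x / 2" and y: "y \<in> ball x (Im x / 2) \<inter> half_strip"
      then have "\<bar>Im (x - y)\<bar> < Im x / 2"
        using abs_Im_le_cmod[of "x - y"] by (auto simp: dist_norm)
      then have "\<beta> n \<le> Im y" using n unfolding minus_complex.sel by linarith
      then show "cmod (F n y) \<le> (1/2) ^ Suc n"
        using y by (intro small) (auto simp: half_strip_def)
    qed
    moreover have "summable (\<lambda>n. (1/2::real) ^ Suc n)"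
      using power_half_series sums_summable by blast
    ultimately show "\<exists>d h. 0 < d \<and> summable h \<and>
        (\<forall>\<^sub>F n in sequentially. \<forall>y\<in>ball x d \<inter> half_strip. norm (F n y) \<le> h n)"
      using Im by (intro exI[of _ "Im x / 2"] exI[of _ "\<lambda>n. (1/2) ^ Suc n"]) auto
  qed
  then obtain g g' where g: "\<forall>x\<in>half_strip. (\<lambda>n. F n x) sums g x \<and> (\<lambda>n. deriv (F n) x) sums g' x \<and>
      (g has_field_derivative g' x) (at x)" by blast
  then have "g holomorphic_on half_strip"
    using holomorphic_on_open[OF open_half_strip] by blast
  with g show ?thesis using that by blast
qed

text \<open>The weights \<open>(1/2) ^ Suc n\<close> add up to 1. A series of approximate steps or
  bumps can thus be compared with the series of their ideal values.\<close>

lemma sums_near: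
  fixes f t :: "nat \<Rightarrow> complex"
  assumes "f sums x" "t sums y" "\<And>n. cmod (f n - t n) \<le> c * (1/2) ^ Suc n"
  shows "cmod (x - y) \<le> c"
proof -
  have d: "(\<lambda>n. f n - t n) sums (x - y)"
    using assms by (intro sums_diff)
  have c: "(\<lambda>n. c * (1/2) ^ Suc n) sums (c * 1)"
    by (intro sums_mult power_half_series)
  have "cmod (suminf (\<lambda>n. f n - t n)) \<le> suminf (\<lambda>n. c * (1/2) ^ Suc n)"
    using assms(3) sums_summable[OF c] by (rule norm_suminf_le)
  then show ?thesis
    using sums_unique[OF d] sums_unique[OF c] by simp
qed

lemma inverse_linear_tendsto_0: "(\<lambda>n. 1 / (8 * real n + c)) \<longlonglongrightarrow> 0"
  by real_asymp

text \<open>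
  Below, heights are measured by \<open>1 / Im z\<close> in periods of length \<open>8\<close>: \<open>h\<close> jumps for \<open>1 / Im z\<close>
  between \<open>8 n + 8\<close> and \<open>8 n + 9\<close>, and \<open>W\<close> leaves \<open>0\<close> only between \<open>8 n + 3\<close> and \<open>8 n + 6\<close>.
\<close>

lemma exists_growing_function:
  obtains h where "h holomorphic_on half_strip"
    "\<And>n z. \<bar>Re z\<bar> < 2 \<Longrightarrow> 1 / (8 * real n + 8) \<le> Im z \<Longrightarrow> Im z \<le> 1 / (8 * real n + 1) \<Longrightarrow>
       real n + 1 \<le> Re (h z)"
proof -
  define a where "a n = 1 / (8 * real n + 9)" for n
  define b where "b n = 1 / (8 * real n + 8)" for n
  have "\<exists>G. G holomorphic_on {z. \<bar>Re z\<bar> < 2} \<and>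
     (\<forall>z. \<bar>Re z\<bar> < 2 \<longrightarrow> 0 \<le> Im z \<longrightarrow> Im z \<le> a n \<longrightarrow> cmod (G z - 1) \<le> (1/2) ^ Suc n) \<and>
     (\<forall>z. \<bar>Re z\<bar> < 2 \<longrightarrow> b n \<le> Im z \<longrightarrow> cmod (G z) \<le> (1/2) ^ Suc n)" for n
    using exists_step_function[of "a n" "b n" "(1/2) ^ Suc n"] unfolding a_def b_def
    by (force simp: frac_less2)
  then obtain G where G: "\<And>n. G n holomorphic_on {z. \<bar>Re z\<bar> < 2}"
     "\<And>n z. \<bar>Re z\<bar> < 2 \<Longrightarrow> 0 \<le> Im z \<Longrightarrow> Im z \<le> a n \<Longrightarrow> cmod (G n z - 1) \<le> (1/2) ^ Suc n"
     "\<And>n z. \<bar>Re z\<bar> < 2 \<Longrightarrow> b n \<le> Im z \<Longrightarrow> cmod (G n z) \<le> (1/2) ^ Suc n"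
    by metis
  have b0: "b \<longlonglongrightarrow> 0"
    unfolding b_def by (rule inverse_linear_tendsto_0)
  obtain g where g: "g holomorphic_on half_strip"
    "\<And>z. z \<in> half_strip \<Longrightarrow> (\<lambda>n. G n z) sums g z"
    using holomorphic_series_half_strip[OF G(1) G(3) b0] by blast
  show ?thesis
  \<comment> \<open>On the \<open>n\<close>-th band exactly the steps \<open>j < n\<close> are
    switched on, so \<open>g\<close> is within 1 of \<open>n\<close>; adding 2 gives at least
    \<open>n + 1\<close>.\<close>
  proof (rule that[of "\<lambda>z. 2 + g z"])
    show "(\<lambda>z. 2 + g z) holomorphic_on half_strip"
      using g(1) by (intro holomorphic_intros)
  next
    fix n z assume z: "\<bar>Re z\<bar> < 2" "1 / (8 * real n + 8) \<le> Im z" "Im z \<le> 1 / (8 * real n + 1)"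
    have Im: "Im z > 0"
      using z(2) by (rule less_le_trans[rotated]) simp
    have s: "(\<lambda>j. G j z) sums g z"
      using g(2) z Im by (simp add: half_strip_def)
    define t :: "nat \<Rightarrow> complex" where "t j = (if j \<in> {..<n} then 1 else 0)" for j
    have "t sums (\<Sum>j<n. 1)"
      unfolding t_def by (rule sums_If_finite_set) simp
    moreover have "cmod (G j z - t j) \<le> 1 * (1/2) ^ Suc j" for j
    proof (cases "j < n")
      case True
      then have "1 / (8 * real n + 1) \<le> a j"
        unfolding a_def by (intro frac_le) auto
      then show ?thesis
        using G(2)[of z j] z Im True by (simp add: t_def)
    next
      case False
      then have "b j \<le> 1 / (8 * real n + 8)"
        unfolding b_def by (intro frac_le) auto
      then show ?thesis
        using G(3)[of z j] z False by (simp add: t_def)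
    qed
    ultimately have "cmod (g z - (\<Sum>j<n. 1)) \<le> 1"
      by (intro sums_near[OF s])
    then have "\<bar>Re (g z - (\<Sum>j<n. 1))\<bar> \<le> 1"
      using abs_Re_le_cmod order_trans by blast
    then show "real n + 1 \<le> Re (2 + g z)" by simp
  qed
qed

text \<open>Each bump is scaled by an arbitrary height \<open>M n\<close>, which can therefore be
  chosen after the size of \<open>h\<close> is known. The strips with \<open>W\<close> near 0 avoid
  all the bumps.\<close>

lemma exists_bump_series:
  fixes M :: "nat \<Rightarrow> real"
  assumes M: "\<And>n. M n \<ge> 0"
  obtains W where "W holomorphic_on half_strip"
    "\<And>n z. \<bar>Re z\<bar> < 2 \<Longrightarrow> 1 / (8 * real n + 10) \<le> Im z \<Longrightarrow> Im z \<le> 1 / (8 * real n + 7) \<Longrightarrow>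
       cmod (W z) \<le> 1/4"
    "\<And>n z. Re z = 0 \<Longrightarrow> 1 / (8 * real n + 5) \<le> Im z \<Longrightarrow> Im z \<le> 1 / (8 * real n + 4) \<Longrightarrow>
       cmod (W z - of_real (M n)) \<le> 1/4"
    "\<And>z. Re z = 0 \<Longrightarrow> 0 < Im z \<Longrightarrow> \<exists>s\<ge>0. cmod (W z - of_real s) \<le> 1/4"
proof -
  define a where "a n = 1 / (8 * real n + 6)" for n
  define p where "p n = 1 / (8 * real n + 5)" for n
  define q where "q n = 1 / (8 * real n + 4)" for n
  define b where "b n = 1 / (8 * real n + 3)" for n
  \<comment> \<open>Dividing by \<open>1 + M n\<close> makes the errors of the scaled bumps sum to
    at most 1/4.\<close>
  define e where "e n = (1/2) ^ Suc n / (4 * (1 + M n))" for n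
  have ord: "0 < a n" "a n < p n" "p n \<le> q n" "q n < b n" for n
    unfolding a_def p_def q_def b_def by (auto intro!: frac_less2 frac_le)
  have e: "e n > 0" for n
    using M[of n] by (simp add: e_def)
  have Me: "M n * e n \<le> 1/4 * (1/2) ^ Suc n" for n
  proof -
    have "x * (c / (4 * y)) = x / y * (1/4 * c)" for x y c :: real
      by simp
    then have "M n * e n = M n / (1 + M n) * (1/4 * (1/2) ^ Suc n)"
      unfolding e_def .
    also have "\<dots> \<le> 1 * (1/4 * (1/2) ^ Suc n)"
      using M[of n] by (intro mult_right_mono) auto
    finally show ?thesis by simp
  qed
  define P where "P n B \<longleftrightarrow> B holomorphic_on {z. \<bar>Re z\<bar> < 2} \<and>
     (\<forall>z. \<bar>Re z\<bar> < 2 \<longrightarrow> 0 \<le> Im z \<longrightarrow> Im z \<le> a n \<or> b n \<le> Im z \<longrightarrow> cmod (B z) \<le> e n) \<and>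
     (\<forall>z. \<bar>Re z\<bar> < 2 \<longrightarrow> p n \<le> Im z \<longrightarrow> Im z \<le> q n \<longrightarrow> cmod (B z - 1) \<le> e n) \<and>
     (\<forall>z. Re z = 0 \<longrightarrow> 0 \<le> Im z \<longrightarrow> (\<exists>s\<in>{0..1}. cmod (B z - of_real s) \<le> e n))" for n B
  have "\<exists>B. P n B" for n
    unfolding P_def by (rule exists_bump_function[OF ord e])
  then obtain B where P: "\<And>n. P n (B n)"
    by metis
  have B: "\<And>n. B n holomorphic_on {z. \<bar>Re z\<bar> < 2}"
     "\<And>n z. \<bar>Re z\<bar> < 2 \<Longrightarrow> 0 \<le> Im z \<Longrightarrow> Im z \<le> a n \<or> b n \<le> Im z \<Longrightarrow> cmod (B n z) \<le> e n"
     "\<And>n z. \<bar>Re z\<bar> < 2 \<Longrightarrow> p n \<le> Im z \<Longrightarrow> Im z \<le> q n \<Longrightarrow> cmod (B n z - 1) \<le> e n"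
     "\<And>n z. Re z = 0 \<Longrightarrow> 0 \<le> Im z \<Longrightarrow> \<exists>s\<in>{0..1}. cmod (B n z - of_real s) \<le> e n"
    using P unfolding P_def by blast+
  have near: "cmod (of_real (M n) * B n z - of_real (M n * s)) \<le> 1/4 * (1/2) ^ Suc n"
    if "cmod (B n z - of_real s) \<le> e n" for n z s
  proof -
    have "cmod (of_real (M n) * B n z - of_real (M n * s)) = M n * cmod (B n z - of_real s)"
      using M[of n] by (simp add: norm_mult flip: right_diff_distrib)
    also have "\<dots> \<le> M n * e n"
      using M[of n] that by (intro mult_left_mono)
    finally show ?thesis using Me[of n] by simp
  qed
  have b0: "b \<longlonglongrightarrow> 0"
    unfolding b_def by (rule inverse_linear_tendsto_0)
  have small: "cmod (of_real (M n) * B n z) \<le> (1/2) ^ Suc n"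
    if "\<bar>Re z\<bar> < 2" "b n \<le> Im z" for n z
  proof -
    have "cmod (of_real (M n) * B n z) \<le> 1/4 * (1/2) ^ Suc n"
      using near[of n z 0] B(2)[of z n] that ord[of n] by simp
    then show ?thesis by (rule order_trans) simp
  qed
  have "(\<lambda>z. of_real (M n) * B n z) holomorphic_on {z. \<bar>Re z\<bar> < 2}" for n
    using B(1) by (intro holomorphic_intros)
  then obtain W where W: "W holomorphic_on half_strip"
    "\<And>z. z \<in> half_strip \<Longrightarrow> (\<lambda>n. of_real (M n) * B n z) sums W z"
    using holomorphic_series_half_strip[of "\<lambda>n z. of_real (M n) * B n z" b] small b0 by blast
  have approx: "cmod (W z - of_real (\<Sum>n\<in>I. M n * s n)) \<le> 1/4"
    if z: "z \<in> half_strip" and I: "finite I" "\<And>n. n \<notin> I \<Longrightarrow> s n = 0"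
      and s: "\<And>n. cmod (B n z - of_real (s n)) \<le> e n" for z I s
  proof (rule sums_near[OF W(2)[OF z]])
    have "(\<lambda>n. M n * s n) sums (\<Sum>n\<in>I. M n * s n)"
      using I by (intro sums_finite) auto
    then show "(\<lambda>n. of_real (M n * s n) :: complex) sums of_real (\<Sum>n\<in>I. M n * s n)"
      by (rule sums_of_real)
  qed (rule near[OF s])
  show ?thesis
  proof (rule that[OF W(1)])
    fix n z assume z: "\<bar>Re z\<bar> < 2" "1 / (8 * real n + 10) \<le> Im z" "Im z \<le> 1 / (8 * real n + 7)"
    have Im: "Im z > 0"
      using z(2) by (rule less_le_trans[rotated]) simp
    have "cmod (B j z) \<le> e j" for j
    proof (rule B(2))
      show "Im z \<le> a j \<or> b j \<le> Im z"
      proof (cases "j \<le> n")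
        case True
        then have "1 / (8 * real n + 7) \<le> a j"
          unfolding a_def by (intro frac_le) auto
        then show ?thesis using z by linarith
      next
        case False
        then have "b j \<le> 1 / (8 * real n + 10)"
          unfolding b_def by (intro frac_le) auto
        then show ?thesis using z by linarith
      qed
    qed (use z Im in auto)
    then show "cmod (W z) \<le> 1/4"
      using approx[of z "{}" "\<lambda>_. 0"] z Im by (simp add: half_strip_def)
  next
    fix n z assume z: "Re z = 0" "1 / (8 * real n + 5) \<le> Im z" "Im z \<le> 1 / (8 * real n + 4)"
    have Im: "Im z > 0"
      using z(2) by (rule less_le_trans[rotated]) simp
    have "cmod (B j z - of_real (if j = n then 1 else 0)) \<le> e j" for j
    proof (cases "j = n")
      case True
      then show ?thesis
        using B(3)[of z n] z by (simp add: p_def q_def)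
    next
      case False
      have "cmod (B j z) \<le> e j"
      proof (rule B(2))
        show "Im z \<le> a j \<or> b j \<le> Im z"
        proof (cases "j < n")
          case True
          then have "1 / (8 * real n + 4) \<le> a j"
            unfolding a_def by (intro frac_le) auto
          then show ?thesis using z by linarith
        next
          case False
          then have "b j \<le> 1 / (8 * real n + 5)"
            using \<open>j \<noteq> n\<close> unfolding b_def by (intro frac_le) auto
          then show ?thesis using z by linarith
        qed
      qed (use z Im in auto)
      then show ?thesis using False by simp
    qed
    then show "cmod (W z - of_real (M n)) \<le> 1/4"
      using approx[of z "{n}" "\<lambda>j. if j = n then 1 else 0"] z Im by (simp add: half_strip_def)
  next
    fix z assume z: "Re z = 0" "0 < Im z"
    obtain s0 where s0: "\<And>j. s0 j \<in> {0..1}" "\<And>j. cmod (B j z - of_real (s0 j)) \<le> e j"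
    proof -
      have "\<forall>j. \<exists>s. s \<in> {0..1} \<and> cmod (B j z - of_real s) \<le> e j"
        using B(4)[OF z(1) less_imp_le[OF z(2)]] by blast
      then show thesis using that by metis
    qed
    \<comment> \<open>From index \<open>m\<close> on, \<open>z\<close> lies above the bump, so the
      ideal value 0 serves as well and the comparison sum becomes finite.\<close>
    obtain m where m: "\<And>j. j \<ge> m \<Longrightarrow> b j < Im z"
      using order_tendstoD(2)[OF b0 z(2)] unfolding eventually_sequentially by blast
    define s where "s j = (if j < m then s0 j else 0)" for j
    have "cmod (B j z - of_real (s j)) \<le> e j" for j
      using s0(2)[of j] B(2)[of z j] m[of j] z by (auto simp: s_def)
    then have "cmod (W z - of_real (\<Sum>j\<in>{..<m}. M j * s j)) \<le> 1/4"
      using z by (intro approx) (auto simp: s_def half_strip_def)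
    moreover have "(\<Sum>j\<in>{..<m}. M j * s j) \<ge> 0"
      using M s0(1) by (intro sum_nonneg mult_nonneg_nonneg) (auto simp: s_def)
    ultimately show "\<exists>s\<ge>0. cmod (W z - of_real s) \<le> 1/4" by blast
  qed
qed

section \<open>The Weierstrass data\<close>

text \<open>The imaginary part is smaller than pi / 3, so the cosine is at least 1/2, and shifting
  the real part by 1/4 costs at most a factor 3/4.\<close>

lemma exp_near_real:
  assumes "cmod (w - of_real s) \<le> 1/4"
  shows "exp s / 4 \<le> Re (exp w)" "cmod (exp (- w)) \<le> 2 * exp (- s)"
proof -
  have "\<bar>Re w - s\<bar> \<le> 1/4" and im: "\<bar>Im w\<bar> \<le> 1/4"
    using assms abs_Re_le_cmod[of "w - of_real s"] abs_Im_le_cmod[of "w - of_real s"] by auto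
  then have re: "s - 1/4 \<le> Re w"
    by linarith
  have e14: "exp (- (1/4)) \<ge> (3/4 :: real)"
    using exp_ge_add_one_self[of "-(1/4)::real"] by simp
  have "cos (pi / 3) \<le> cos \<bar>Im w\<bar>"
    using im pi_gt3 by (intro cos_monotone_0_pi_le) auto
  then have cos: "cos (Im w) \<ge> 1/2"
    by (simp add: cos_60)
  have "exp s / 4 \<le> (exp s * (3/4)) * (1/2)" by simp
  also have "\<dots> \<le> exp (Re w) * cos (Im w)"
  proof (intro mult_mono)
    have "exp s * (3/4) \<le> exp s * exp (- (1/4))"
      using e14 by (intro mult_left_mono) auto
    also have "\<dots> = exp (s - 1/4)"
      by (simp flip: exp_add)
    also have "\<dots> \<le> exp (Re w)"
      using re by simp
    finally show "exp s * (3/4) \<le> exp (Re w)" .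
  qed (use cos in auto)
  finally show "exp s / 4 \<le> Re (exp w)" by (simp add: Re_exp)
  have "cmod (exp (- w)) = exp (- Re w)"
    by simp
  also have "\<dots> \<le> exp (1/4 - s)"
    using re by simp
  also have "\<dots> = exp (- s) / exp (- (1/4))"
    by (simp flip: exp_diff)
  also have "\<dots> \<le> exp (- s) / (1/2)"
    using e14 by (intro divide_left_mono) auto
  finally show "cmod (exp (- w)) \<le> 2 * exp (- s)" by simp
qed

lemma primitive_half_strip:
  assumes "f holomorphic_on half_strip" "z0 \<in> half_strip"
  obtains F where "F holomorphic_on half_strip" "F z0 = 0"
    "\<And>z. z \<in> half_strip \<Longrightarrow> (F has_field_derivative f z) (at z)"
proof -
  obtain F where F: "\<And>z. z \<in> half_strip \<Longrightarrow> (F has_field_derivative f z) (at z within half_strip)"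
    using holomorphic_convex_primitive'[OF convex_half_strip open_half_strip assms(1)] by blast
  define G where "G z = F z - F z0" for z
  have G: "(G has_field_derivative f z) (at z)" if "z \<in> half_strip" for z
    using F[OF that] that unfolding G_def
    by (auto simp: at_within_open[OF that open_half_strip] intro!: derivative_eq_intros)
  then have "G holomorphic_on half_strip"
    using holomorphic_on_open[OF open_half_strip] by blast
  with G show ?thesis
    using that[of G] by (simp add: G_def)
qed

section \<open>Growth along the imaginary axis and the choice of the data\<close>

lemma Re_along_imaginary_axis:
  assumes "(F has_field_derivative D) (at (\<i> * of_real y))"
  shows "((\<lambda>y. Re (F (\<i> * of_real y))) has_real_derivative Re (\<i> * D)) (at y)"
proof -
  have "((\<lambda>y. \<i> * of_real y) has_vector_derivative \<i>) (at y)"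
    by (auto intro!: derivative_eq_intros simp: has_vector_derivative_def scaleR_conv_of_real)
  then have "((F \<circ> (\<lambda>y. \<i> * of_real y)) has_vector_derivative \<i> * D) (at y)"
    by (rule field_vector_diff_chain_at) (use assms in simp)
  then have "((\<lambda>y. Re (F (\<i> * of_real y))) has_vector_derivative Re (\<i> * D)) (at y)"
    unfolding o_def by (rule bounded_linear.has_vector_derivative[OF bounded_linear_Re])
  then show ?thesis
    by (simp add: has_real_derivative_iff_has_vector_derivative)
qed

lemma DERIV_upper_bound_le:
  fixes f :: "real \<Rightarrow> real"
  assumes "a \<le> b" "\<And>x. a \<le> x \<Longrightarrow> x \<le> b \<Longrightarrow> \<exists>y. (f has_real_derivative y) (at x) \<and> y \<le> c"
  shows "f b \<le> f a + c * (b - a)"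
proof -
  have "f b - c * b \<le> f a - c * a"
  proof (rule DERIV_nonpos_imp_nonincreasing[OF assms(1)])
    fix x assume "a \<le> x" "x \<le> b"
    then obtain y where "(f has_real_derivative y) (at x)" "y \<le> c"
      using assms(2) by blast
    then show "\<exists>y. ((\<lambda>x. f x - c * x) has_real_derivative y) (at x) \<and> y \<le> 0"
      by (intro exI[of _ "y - c"]) (auto intro!: derivative_eq_intros)
  qed
  then show ?thesis by (simp add: algebra_simps)
qed

lemma bounded_on_cbox:
  fixes f :: "complex \<Rightarrow> complex"
  assumes "f holomorphic_on S" "cbox a b \<subseteq> S"
  obtains A where "A \<ge> 0" "\<And>z. z \<in> cbox a b \<Longrightarrow> cmod (f z) \<le> A"
proof -
  have "continuous_on (cbox a b) f"
    using assms continuous_on_subset holomorphic_on_imp_continuous_on by blast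
  then have "bounded (f ` cbox a b)"
    using compact_continuous_image compact_imp_bounded compact_cbox by blast
  then show ?thesis
    using that unfolding bounded_pos by (metis image_eqI less_imp_le)
qed

text \<open>The order of choice matters: first \<open>h\<close>, then its bounds on compact
  rectangles, then the heights \<open>M\<close> and \<open>W\<close>, and finally \<open>g\<close>
  and \<open>k\<close> by integration. The gaps left by the strips where \<open>h\<close> is large
  lie inside the strips where \<open>W\<close> is near 0.\<close>

lemma exists_weierstrass_data:
  obtains g k h where
    "g holomorphic_on half_strip" "k holomorphic_on half_strip" "h holomorphic_on half_strip"
    "\<And>z. z \<in> half_strip \<Longrightarrow> (deriv g z)\<^sup>2 + (deriv k z)\<^sup>2 + (deriv h z)\<^sup>2 = 0"
    "\<And>z. z \<in> half_strip \<Longrightarrow> deriv g z \<noteq> 0 \<or> deriv k z \<noteq> 0"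
    "\<And>n z. \<bar>Re z\<bar> \<le> 1 \<Longrightarrow> 1 / (8 * real n + 9) \<le> Im z \<Longrightarrow> Im z \<le> 1 / (8 * real n + 1) \<Longrightarrow>
      real n + 1 \<le> Re (h z) \<or>
      real n + 1 \<le> Re (g z) \<and> - Re (g z) / (real n + 1) \<le> Re (h z)"
proof -
  obtain h where h: "h holomorphic_on half_strip"
    and h_large: "\<And>n z. \<bar>Re z\<bar> < 2 \<Longrightarrow> 1 / (8 * real n + 8) \<le> Im z \<Longrightarrow>
      Im z \<le> 1 / (8 * real n + 1) \<Longrightarrow> real n + 1 \<le> Re (h z)"
    by (rule exists_growing_function) (rule that)
  define h' where "h' = deriv h"
  have h': "h' holomorphic_on half_strip"
    unfolding h'_def using h open_half_strip by (rule holomorphic_deriv)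
  \<comment> \<open>The lower edge lies below the \<open>n\<close>-th gap, which starts at
    \<open>1 / (8 * real n + 9)\<close>; compactness gives the bounds \<open>A n\<close> and
    \<open>H n\<close>.\<close>
  define Q where "Q n = cbox (Complex (-1) (1 / (8 * real n + 10))) (Complex 1 1)" for n
  have Q: "z \<in> Q n \<longleftrightarrow> \<bar>Re z\<bar> \<le> 1 \<and> 1 / (8 * real n + 10) \<le> Im z \<and> Im z \<le> 1" for n z
    by (auto simp: Q_def in_cbox_complex_iff)
  have QU: "Q n \<subseteq> half_strip" for n
  proof
    fix z assume z: "z \<in> Q n"
    have "0 < 1 / (8 * real n + 10)" by simp
    also have "\<dots> \<le> Im z" using z by (simp add: Q)
    finally show "z \<in> half_strip" using z by (auto simp: Q half_strip_def)
  qed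
  have "\<exists>A. A \<ge> 0 \<and> (\<forall>z\<in>Q n. cmod (h z) \<le> A)" for n
    unfolding Q_def by (rule bounded_on_cbox[OF h QU[unfolded Q_def]]) blast
  then obtain A where A: "\<And>n. A n \<ge> 0" "\<And>n z. z \<in> Q n \<Longrightarrow> cmod (h z) \<le> A n"
    by metis
  have "\<exists>A. A \<ge> 0 \<and> (\<forall>z\<in>Q n. cmod (h' z) \<le> A)" for n
    unfolding Q_def by (rule bounded_on_cbox[OF h' QU[unfolded Q_def]]) blast
  then obtain H where H: "\<And>n. H n \<ge> 0" "\<And>n z. z \<in> Q n \<Longrightarrow> cmod (h' z) \<le> H n"
    by metis
  \<comment> \<open>\<open>D n\<close> is the gain of \<open>Re g\<close> wanted on the plateau of height \<open>M n\<close> and width \<open>l n\<close>.\<close>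
  define D where "D n = 2 + 3 * (H n)\<^sup>2 + (real n + 1) * (1 + A n)" for n
  define l where "l n = 1 / (8 * real n + 4) - 1 / (8 * real n + 5)" for n
  define M where "M n = 8 * D n / l n" for n
  have l: "l n > 0" for n
    by (simp add: l_def frac_less2)
  have D: "D n \<ge> 0" for n
    using A(1) H(1) by (simp add: D_def)
  have M: "M n \<ge> 0" for n
    using l D by (simp add: M_def less_imp_le)
  obtain W where W: "W holomorphic_on half_strip"
    and W0: "\<And>n z. \<bar>Re z\<bar> < 2 \<Longrightarrow> 1 / (8 * real n + 10) \<le> Im z \<Longrightarrow> Im z \<le> 1 / (8 * real n + 7) \<Longrightarrow>
       cmod (W z) \<le> 1/4"
    and WM: "\<And>n z. Re z = 0 \<Longrightarrow> 1 / (8 * real n + 5) \<le> Im z \<Longrightarrow> Im z \<le> 1 / (8 * real n + 4) \<Longrightarrow>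
       cmod (W z - of_real (M n)) \<le> 1/4"
    and Wpos: "\<And>z. Re z = 0 \<Longrightarrow> 0 < Im z \<Longrightarrow> \<exists>s\<ge>0. cmod (W z - of_real s) \<le> 1/4"
    by (rule exists_bump_series[OF M]) (rule that)
  \<comment> \<open>Since \<open>a z * b z = (h' z)\<^sup>2\<close>, the derivatives
    \<open>\<i> / 2 * (a z + b z)\<close> and \<open>- (a z - b z) / 2\<close> have squares adding
    up to \<open>- (h' z)\<^sup>2\<close>.\<close>
  define a where "a z = exp (W z)" for z
  define b where "b z = (h' z)\<^sup>2 * exp (- W z)" for z
  have ab: "a holomorphic_on half_strip" "b holomorphic_on half_strip"
    unfolding a_def b_def using W h' by (auto intro!: holomorphic_intros)
  have i: "\<i> \<in> half_strip" by (simp add: half_strip_def)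
  have "(\<lambda>z. \<i> / 2 * (a z + b z)) holomorphic_on half_strip"
    using ab by (auto intro!: holomorphic_intros)
  then obtain g where g: "g holomorphic_on half_strip" "g \<i> = 0"
      "\<And>z. z \<in> half_strip \<Longrightarrow> (g has_field_derivative \<i> / 2 * (a z + b z)) (at z)"
    by (rule primitive_half_strip[OF _ i]) (rule that)
  have "(\<lambda>z. - (a z - b z) / 2) holomorphic_on half_strip"
    using ab by (auto intro!: holomorphic_intros)
  then obtain k where k: "k holomorphic_on half_strip"
      "\<And>z. z \<in> half_strip \<Longrightarrow> (k has_field_derivative - (a z - b z) / 2) (at z)"
    by (rule primitive_half_strip[OF _ i]) (rule that)
  \<comment> \<open>Going up the axis, \<open>Re g\<close> has derivative
    \<open>- (Re a + Re b) / 2\<close>. Here \<open>Re a\<close> is at least \<open>s / 4\<close>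
    because the exponential dominates \<open>s\<close>, and \<open>b\<close> is bounded by
    \<open>2 * (H n)\<^sup>2\<close>.\<close>
  have axis: "\<exists>y'. ((\<lambda>y. Re (g (\<i> * of_real y))) has_real_derivative y') (at y) \<and>
      y' \<le> (H n)\<^sup>2 - s / 8"
    if y: "1 / (8 * real n + 10) \<le> y" "y \<le> 1" and s: "s \<ge> 0" "cmod (W (\<i> * of_real y) - of_real s) \<le> 1/4"
    for y n s
  proof -
    let ?z = "\<i> * of_real y"
    have z: "?z \<in> Q n" using y by (simp add: Q)
    then have "((\<lambda>y. Re (g (\<i> * of_real y))) has_real_derivative Re (\<i> * (\<i> / 2 * (a ?z + b ?z)))) (at y)"
      using QU by (intro Re_along_imaginary_axis g(3)) auto
    moreover have "Re (\<i> * (\<i> / 2 * (a ?z + b ?z))) = - (Re (a ?z) + Re (b ?z)) / 2"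
      by simp
    moreover have "s / 4 \<le> Re (a ?z)"
      using exp_near_real(1)[OF s(2)] exp_ge_add_one_self[of s] unfolding a_def by linarith
    moreover have "- Re (b ?z) \<le> 2 * (H n)\<^sup>2"
    proof -
      have "cmod (exp (- W ?z)) \<le> 2 * exp (- s)"
        by (rule exp_near_real(2)[OF s(2)])
      also have "\<dots> \<le> 2" using s(1) by simp
      finally have e: "cmod (exp (- W ?z)) \<le> 2" .
      have "cmod (b ?z) = (cmod (h' ?z))\<^sup>2 * cmod (exp (- W ?z))"
        unfolding b_def norm_mult norm_power ..
      also have "\<dots> \<le> (H n)\<^sup>2 * 2"
        using H(2)[OF z] e by (intro mult_mono power_mono) auto
      finally show ?thesis
        using abs_Re_le_cmod[of "b ?z"] by simp
    qed
    ultimately show ?thesis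
      by (intro exI[of _ "Re (\<i> * (\<i> / 2 * (a ?z + b ?z)))"]) auto
  qed
  \<comment> \<open>Descending from height 1, where \<open>g\<close> is 0, the plateau yields
    \<open>D n\<close>, while the term \<open>(H n)\<^sup>2\<close> acts over a total length of at
    most 1.\<close>
  have at_axis: "Re (g (\<i> * of_real (1 / (8 * real n + 7)))) \<ge> D n - (H n)\<^sup>2" for n
  proof -
    let ?u = "\<lambda>y. Re (g (\<i> * of_real y))"
    define y1 y2 y3 where "y1 = 1 / (8 * real n + 7)" and "y2 = 1 / (8 * real n + 5)"
      and "y3 = 1 / (8 * real n + 4)"
    have y: "1 / (8 * real n + 10) \<le> y1" "0 < y1" "y1 \<le> y2" "y2 \<le> y3" "y3 \<le> 1"
      by (auto simp: y1_def y2_def y3_def intro!: frac_le)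
    have bound: "\<exists>y'. (?u has_real_derivative y') (at t) \<and> y' \<le> (H n)\<^sup>2" if t: "y1 \<le> t" "t \<le> 1" for t
    proof -
      obtain s where "s \<ge> 0" "cmod (W (\<i> * of_real t) - of_real s) \<le> 1/4"
        using Wpos[of "\<i> * of_real t"] t y by auto
      then show ?thesis
        using axis[of n t s] t y by force
    qed
    have "?u y2 \<le> ?u y1 + (H n)\<^sup>2 * (y2 - y1)"
      using y bound by (intro DERIV_upper_bound_le) auto
    moreover have "?u y3 \<le> ?u y2 + ((H n)\<^sup>2 - M n / 8) * (y3 - y2)"
    proof (rule DERIV_upper_bound_le)
      fix t assume t: "y2 \<le> t" "t \<le> y3"
      have "cmod (W (\<i> * of_real t) - of_real (M n)) \<le> 1/4"
        using t by (intro WM[of _ n]) (auto simp: y2_def y3_def)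
      then show "\<exists>y'. (?u has_real_derivative y') (at t) \<and> y' \<le> (H n)\<^sup>2 - M n / 8"
        using t y M by (intro axis) auto
    qed (use y in auto)
    moreover have "?u 1 \<le> ?u y3 + (H n)\<^sup>2 * (1 - y3)"
      using y bound by (intro DERIV_upper_bound_le) auto
    moreover have "?u 1 = 0" using g(2) by simp
    moreover have "M n / 8 * (y3 - y2) = D n"
    proof -
      have "M n / 8 * l n = D n"
        using l[of n] by (simp add: M_def)
      then show ?thesis
        unfolding l_def y2_def y3_def .
    qed
    moreover have "(H n)\<^sup>2 * y1 \<ge> 0" using y by simp
    ultimately show ?thesis
      unfolding y1_def[symmetric] by (simp add: algebra_simps)
  qed
  \<comment> \<open>Where \<open>W\<close> is near 0 the derivative of \<open>g\<close> is at most
    \<open>1 + (H n)\<^sup>2\<close>, and the point on the axis is within distance 2. The loss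
    \<open>2 + 2 * (H n)\<^sup>2\<close>, together with that of \<open>at_axis\<close>, is what the
    first summands of \<open>D n\<close> pay for.\<close>
  have g_large: "(real n + 1) * (1 + A n) \<le> Re (g z)"
    if z: "\<bar>Re z\<bar> \<le> 1" "1 / (8 * real n + 10) \<le> Im z" "Im z \<le> 1 / (8 * real n + 7)" for n z
  proof -
    define y1 where "y1 = 1 / (8 * real n + 7)"
    have y1: "1 / (8 * real n + 10) \<le> y1" "0 < y1" "y1 \<le> 1"
      by (auto simp: y1_def intro!: frac_le)
    define S where "S = cbox (Complex (-1) (1 / (8 * real n + 10))) (Complex 1 y1)"
    have S: "w \<in> S \<longleftrightarrow> \<bar>Re w\<bar> \<le> 1 \<and> 1 / (8 * real n + 10) \<le> Im w \<and> Im w \<le> y1" for w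
      by (auto simp: S_def in_cbox_complex_iff)
    have SQ: "w \<in> Q n" if "w \<in> S" for w
      using that y1 unfolding S Q by linarith
    let ?p = "\<i> * of_real y1"
    have p: "?p \<in> S" using y1 by (simp add: S)
    have zS: "z \<in> S" using z by (simp add: S y1_def)
    have "cmod (g z - g ?p) \<le> (1 + (H n)\<^sup>2) * cmod (z - ?p)"
    proof (rule field_differentiable_bound[of S])
      show "convex S" unfolding S_def by (rule convex_box)
      fix w assume w: "w \<in> S"
      show "(g has_field_derivative \<i> / 2 * (a w + b w)) (at w within S)"
        using SQ[OF w] QU[of n] by (intro has_field_derivative_at_within[OF g(3)]) blast
      have Ww: "cmod (W w - of_real 0) \<le> 1/4"
        using W0[of w n] w by (auto simp: S y1_def)
      have e: "cmod (exp (- W w)) \<le> 2" using exp_near_real(2)[OF Ww] by simp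
      \<comment> \<open>The bound on \<open>exp (- w)\<close> is applied to \<open>- W w\<close>,
        giving an upper bound for \<open>exp (W w)\<close>.\<close>
      have Ww': "cmod (- W w - of_real 0) \<le> 1/4" using Ww by simp
      have e': "cmod (a w) \<le> 2" using exp_near_real(2)[OF Ww'] by (simp add: a_def)
      have "cmod (b w) = (cmod (h' w))\<^sup>2 * cmod (exp (- W w))"
        unfolding b_def norm_mult norm_power ..
      also have "\<dots> \<le> (H n)\<^sup>2 * 2"
        using H(2)[OF SQ[OF w]] e by (intro mult_mono power_mono) auto
      finally have "cmod (a w + b w) \<le> 2 + (H n)\<^sup>2 * 2"
        using e' norm_triangle_ineq[of "a w" "b w"] by linarith
      then show "cmod (\<i> / 2 * (a w + b w)) \<le> 1 + (H n)\<^sup>2"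
        by (simp add: norm_mult norm_divide)
    qed (use zS p in auto)
    also have "\<dots> \<le> (1 + (H n)\<^sup>2) * 2"
    proof (intro mult_left_mono)
      have "cmod (z - ?p) \<le> \<bar>Re (z - ?p)\<bar> + \<bar>Im (z - ?p)\<bar>" by (rule cmod_le)
      moreover have "\<bar>Im z - y1\<bar> \<le> 1"
      proof -
        have "0 < 1 / (8 * real n + 10)" by simp
        then show ?thesis using z y1 unfolding y1_def[symmetric] by linarith
      qed
      ultimately show "cmod (z - ?p) \<le> 2"
        using z by simp
    qed simp
    finally have "\<bar>Re (g z - g ?p)\<bar> \<le> 2 + 2 * (H n)\<^sup>2"
      using abs_Re_le_cmod[of "g z - g ?p"] by (simp add: algebra_simps)
    then show ?thesis
      using at_axis[of n] unfolding y1_def[symmetric] by (simp add: D_def)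
  qed
  show ?thesis
  proof (rule that[OF g(1) k(1) h])
    fix z assume z: "z \<in> half_strip"
    have dg: "deriv g z = \<i> / 2 * (a z + b z)" and dk: "deriv k z = - (a z - b z) / 2"
      by (rule DERIV_imp_deriv[OF g(3)[OF z]], rule DERIV_imp_deriv[OF k(2)[OF z]])
    have hz: "(deriv h z)\<^sup>2 = a z * b z"
      by (simp add: a_def b_def h'_def exp_minus)
    show "(deriv g z)\<^sup>2 + (deriv k z)\<^sup>2 + (deriv h z)\<^sup>2 = 0"
      unfolding dg dk hz by (simp add: power2_eq_square field_simps)
    \<comment> \<open>If both derivatives vanished, the sum and the difference of \<open>a z\<close>
      and \<open>b z\<close> would be 0, forcing \<open>a z = 0\<close>.\<close>
    have "a z \<noteq> 0" by (simp add: a_def)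
    then show "deriv g z \<noteq> 0 \<or> deriv k z \<noteq> 0"
      unfolding dg dk by (auto simp: add_eq_0_iff2)
  next
    fix n z
    assume z: "\<bar>Re z\<bar> \<le> 1" "1 / (8 * real n + 9) \<le> Im z" "Im z \<le> 1 / (8 * real n + 1)"
    show "real n + 1 \<le> Re (h z) \<or> real n + 1 \<le> Re (g z) \<and> - Re (g z) / (real n + 1) \<le> Re (h z)"
    proof (cases "1 / (8 * real n + 8) \<le> Im z")
      case True
      then show ?thesis using h_large[of z n] z by simp
    next
      \<comment> \<open>This is the gap: \<open>h\<close> is bounded only by \<open>A n\<close>, but
        \<open>Re g\<close> is at least \<open>(real n + 1) * (1 + A n)\<close>.\<close>
      case False
      have fr: "1 / (8 * real n + 10) \<le> 1 / (8 * real n + 9)" "1 / (8 * real n + 8) \<le> 1 / (8 * real n + 7)"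
        "1 / (8 * real n + 1) \<le> 1"
        by (auto intro!: frac_le)
      then have zz: "1 / (8 * real n + 10) \<le> Im z" "Im z \<le> 1 / (8 * real n + 7)" "Im z \<le> 1"
        using z False by linarith+
      have gz: "(real n + 1) * (1 + A n) \<le> Re (g z)"
        by (rule g_large[OF z(1) zz(1,2)])
      have "z \<in> Q n" using z zz by (simp add: Q)
      then have "cmod (h z) \<le> A n" by (rule A(2))
      then have "- A n \<le> Re (h z)"
        using abs_Re_le_cmod[of "h z"] by linarith
      moreover have "(real n + 1) * A n \<ge> 0" using A(1) by simp
      moreover have "- Re (g z) / (real n + 1) \<le> - A n"
        using gz A(1)[of n] by (simp add: field_simps) 
      ultimately show ?thesis using gz by (auto simp: algebra_simps)
    qed
  qed
qed

section \<open>The immersion\<close>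

lemma half_open_rectangle_truncation:
  assumes "a > 0"
  shows "{z \<in> half_open_rectangle. a \<le> Im z} = cbox (Complex (-1) a) (Complex 1 1)"
  using assms by (auto simp: half_open_rectangle_def in_cbox_complex_iff)

text \<open>The preimage of a compact set is closed in a compact truncation, hence compact. Since
  the target is metrizable, compact preimages and continuity suffice for a proper map.\<close>

lemma proper_map_half_open_rectangle:
  fixes F :: "complex \<Rightarrow> 'a::metric_space"
  assumes cont: "continuous_on half_open_rectangle F"
    and escape: "\<And>T. bounded T \<Longrightarrow> \<exists>a>0. \<forall>z\<in>half_open_rectangle. F z \<in> T \<longrightarrow> a \<le> Im z"
  shows "proper_map (top_of_set half_open_rectangle) euclidean F"
proof (rule compact_imp_proper_map)
  fix T :: "'a set" assume "compactin euclidean T"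
  then have T: "compact T" by simp
  then obtain a where a: "a > 0" "\<forall>z\<in>half_open_rectangle. F z \<in> T \<longrightarrow> a \<le> Im z"
    using escape compact_imp_bounded by blast
  define K where "K = cbox (Complex (-1) a) (Complex 1 1)"
  have K: "K = {z \<in> half_open_rectangle. a \<le> Im z}"
    unfolding K_def by (rule half_open_rectangle_truncation[OF a(1), symmetric])
  have "continuous_on K F"
    using cont by (rule continuous_on_subset) (auto simp: K)
  then have "closed (K \<inter> F -` T)"
    using T by (intro continuous_closed_preimage) (auto simp: K_def compact_imp_closed closed_cbox)
  then have "compact (K \<inter> (K \<inter> F -` T))"
    by (intro compact_Int_closed) (auto simp: K_def)
  moreover have "{z \<in> topspace (top_of_set half_open_rectangle). F z \<in> T} = K \<inter> (K \<inter> F -` T)"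
    using a(2) by (auto simp: K)
  ultimately show "compactin (top_of_set half_open_rectangle) {z \<in> topspace (top_of_set half_open_rectangle). F z \<in> T}"
    by (auto simp: compactin_subtopology K)
qed (use cont in \<open>auto simp: continuous_map_in_subtopology intro: Hausdorff_imp_kc_space metrizable_imp_k_space metrizable_space_euclidean\<close>)

text \<open>The bands fill all heights in (0,1]; writing the height as
  \<open>1 / (8 * t + 1)\<close>, the index is the integer part of \<open>t\<close>.\<close>

lemma half_open_rectangle_strip:
  assumes "z \<in> half_open_rectangle" "Im z \<le> 1 / (8 * real N + 1)"
  obtains n where "n \<ge> N" "1 / (8 * real n + 9) \<le> Im z" "Im z \<le> 1 / (8 * real n + 1)"
proof -
  define t where "t = (1 / Im z - 1) / 8"
  have Im: "0 < Im z" "Im z \<le> 1"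
    using assms(1) by (auto simp: half_open_rectangle_def)
  have "8 * t + 1 = 1 / Im z"
  proof -
    have "8 * ((r - 1) / 8) + 1 = r" for r :: real
      by (simp add: field_simps)
    then show ?thesis unfolding t_def .
  qed
  then have eq: "Im z = 1 / (8 * t + 1)"
    using Im by simp
  have "8 * real N + 1 \<le> 1 / Im z"
    using assms(2) Im by (simp add: field_simps)
  then have t: "real N \<le> t" by (simp add: t_def)
  define n where "n = nat \<lfloor>t\<rfloor>"
  have n: "real n \<le> t" "t \<le> real n + 1" "N \<le> n"
    using t by (auto simp: n_def le_nat_floor)
  show ?thesis
    by (rule that[OF n(3)]) (use n t in \<open>auto simp: eq intro!: frac_le\<close>)
qed

theorem theorem6p1:
  shows "\<exists>X \<in> conformal_minimal_immersions half_open_rectangle.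
    proper_map (top_of_set half_open_rectangle) euclidean (\<lambda>z. (X z $ 1, X z $ 3)) \<and>
    (let f = (\<lambda>z. min (X z $ 3 / (\<bar>X z $ 1\<bar> + 1)) 0) in
      (\<forall>z \<in> half_open_rectangle. X z $ 1 \<le> 0 \<longrightarrow> f z = 0) \<and>
      (\<forall>P. divergent_seq_in half_open_rectangle P \<longrightarrow> (\<lambda>n. f (P n)) \<longlonglongrightarrow> 0))"
proof -
  obtain g k h where holo: "g holomorphic_on half_strip" "k holomorphic_on half_strip" "h holomorphic_on half_strip"
    and null: "\<And>z. z \<in> half_strip \<Longrightarrow> (deriv g z)\<^sup>2 + (deriv k z)\<^sup>2 + (deriv h z)\<^sup>2 = 0"
    and nz: "\<And>z. z \<in> half_strip \<Longrightarrow> deriv g z \<noteq> 0 \<or> deriv k z \<noteq> 0"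
    and strip: "\<And>n z. \<bar>Re z\<bar> \<le> 1 \<Longrightarrow> 1 / (8 * real n + 9) \<le> Im z \<Longrightarrow> Im z \<le> 1 / (8 * real n + 1) \<Longrightarrow>
      real n + 1 \<le> Re (h z) \<or>
      real n + 1 \<le> Re (g z) \<and> - Re (g z) / (real n + 1) \<le> Re (h z)"
    by (rule exists_weierstrass_data) (rule that)
  define f :: "3 \<Rightarrow> complex \<Rightarrow> complex" where "f i = (if i = 1 then g else if i = 2 then k else h)" for i
  have f: "f 1 = g" "f 2 = k" "f 3 = h"
    by (simp_all add: f_def)
  define X :: "complex \<Rightarrow> real^3" where "X = (\<lambda>z. \<chi> i. Re (f i z))"
  have X: "X z $ 1 = Re (g z)" "X z $ 3 = Re (h z)" for z
    by (simp_all add: X_def f)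
  have sub: "half_open_rectangle \<subseteq> half_strip"
    by (auto simp: half_open_rectangle_def half_strip_def)
  have "conformal_minimal_immersion_on half_strip X"
    unfolding X_def
  proof (rule conformal_minimal_immersion_on_Re_vec[OF open_half_strip])
    show "f i holomorphic_on half_strip" for i
      using holo by (simp add: f_def)
    fix z assume z: "z \<in> half_strip"
    show "(\<Sum>i\<in>UNIV. (deriv (f i) z)\<^sup>2) = 0"
      using null[OF z] by (simp add: sum_3 f)
    show "\<exists>i. deriv (f i) z \<noteq> 0"
      using nz[OF z] f by metis
  qed
  then have mem: "X \<in> conformal_minimal_immersions half_open_rectangle"
    unfolding conformal_minimal_immersions_def
    using open_half_strip convex_connected[OF convex_half_strip] sub by blast
  have large: "\<exists>n\<ge>N. real n + 1 \<le> Re (h z) \<or>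
      real n + 1 \<le> Re (g z) \<and> - Re (g z) / (real n + 1) \<le> Re (h z)"
    if z: "z \<in> half_open_rectangle" "Im z \<le> 1 / (8 * real N + 1)" for z N
  proof -
    obtain n where n: "n \<ge> N" "1 / (8 * real n + 9) \<le> Im z" "Im z \<le> 1 / (8 * real n + 1)"
      by (rule half_open_rectangle_strip[OF z])
    moreover have "\<bar>Re z\<bar> \<le> 1"
      using z by (auto simp: half_open_rectangle_def)
    ultimately show ?thesis using strip by blast
  qed
  have proper: "proper_map (top_of_set half_open_rectangle) euclidean (\<lambda>z. (X z $ 1, X z $ 3))"
  proof (rule proper_map_half_open_rectangle)
    show "continuous_on half_open_rectangle (\<lambda>z. (X z $ 1, X z $ 3))"
      unfolding X using holo sub
      by (intro continuous_intros) (blast intro: holomorphic_on_imp_continuous_on continuous_on_subset)+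
  next
    fix T :: "(real \<times> real) set" assume "bounded T"
    then obtain B where B: "\<And>p. p \<in> T \<Longrightarrow> norm p \<le> B"
      unfolding bounded_iff by blast
    \<comment> \<open>Below height \<open>1 / (8 * real N + 1)\<close> one of the two coordinates is
      at least \<open>real N + 1\<close>, hence exceeds \<open>B\<close>.\<close>
    obtain N :: nat where N: "B < real N"
      using reals_Archimedean2 by blast
    have "1 / (8 * real N + 1) \<le> Im z"
      if z: "z \<in> half_open_rectangle" "(X z $ 1, X z $ 3) \<in> T" for z
    proof (rule ccontr)
      assume "\<not> 1 / (8 * real N + 1) \<le> Im z"
      then obtain n where "n \<ge> N" "real n + 1 \<le> Re (h z) \<or> real n + 1 \<le> Re (g z)"
        using large[of z N] z(1) by auto
      moreover have "\<bar>Re (g z)\<bar> \<le> B" "\<bar>Re (h z)\<bar> \<le> B"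
        using B[OF z(2)] norm_fst_le[where x = "X z $ 1" and y = "X z $ 3"]
          norm_snd_le[where x = "X z $ 1" and y = "X z $ 3"]
        by (auto simp: X)
      ultimately show False using N by linarith
    qed
    then show "\<exists>a>0. \<forall>z\<in>half_open_rectangle. (X z $ 1, X z $ 3) \<in> T \<longrightarrow> a \<le> Im z"
      by (intro exI[of _ "1 / (8 * real N + 1)"]) auto
  qed
  define q where "q z = min (X z $ 3 / (\<bar>X z $ 1\<bar> + 1)) 0" for z
  have q_nonpos: "q z = 0" if z: "z \<in> half_open_rectangle" "X z $ 1 \<le> 0" for z
  proof -
    \<comment> \<open>For index 0 the height bound is 1, so the alternative from
      \<open>large\<close> holds on the whole rectangle; \<open>X z $ 1 \<le> 0\<close> excludes the
      branch with \<open>Re (g z)\<close> positive.\<close>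
    have "Im z \<le> 1 / (8 * real 0 + 1)"
      using z(1) by (simp add: half_open_rectangle_def)
    then obtain n where n: "real n + 1 \<le> Re (h z) \<or> real n + 1 \<le> Re (g z)"
      using large[of z 0] z(1) by blast
    have "0 \<le> Re (h z)"
      using n z(2) unfolding X by linarith
    then show ?thesis by (simp add: q_def X)
  qed
  have q_small: "\<bar>q z\<bar> \<le> 1 / (real N + 1)"
    if z: "z \<in> half_open_rectangle" "Im z \<le> 1 / (8 * real N + 1)" for z N
  proof -
    obtain n where n: "n \<ge> N" "real n + 1 \<le> Re (h z) \<or>
      real n + 1 \<le> Re (g z) \<and> - Re (g z) / (real n + 1) \<le> Re (h z)"
      using large[OF z] by blast
    have "- (1 / (real N + 1)) \<le> Re (h z) / (\<bar>Re (g z)\<bar> + 1)"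
    proof (cases "0 \<le> Re (h z)")
      case True
      then have "0 \<le> Re (h z) / (\<bar>Re (g z)\<bar> + 1)" by simp
      moreover have "0 \<le> 1 / (real N + 1)" by simp
      ultimately show ?thesis by linarith
    next
      case False
      then have g: "0 \<le> Re (g z)" "- Re (g z) / (real n + 1) \<le> Re (h z)"
        using n(2) by linarith+
      \<comment> \<open>Enlarging the numerator by 1 matches the denominator
        \<open>\<bar>Re (g z)\<bar> + 1\<close> of the quotient, which then cancels.\<close>
      have "Re (g z) / (real n + 1) \<le> (Re (g z) + 1) / (real N + 1)"
        using g(1) n(1) by (intro frac_le) auto
      with g(2) have "- ((Re (g z) + 1) / (real N + 1)) \<le> Re (h z)"
        by linarith
      then show ?thesis using g(1) by (simp add: field_simps)
    qed
    then show ?thesis by (simp add: q_def X min_def abs_if)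
  qed
  have q_lim: "(\<lambda>n. q (P n)) \<longlonglongrightarrow> 0" if P: "divergent_seq_in half_open_rectangle P" for P
  proof (rule tendstoI)
    fix e :: real assume e: "e > 0"
    obtain N :: nat where N: "1 / (real N + 1) < e"
      using reals_Archimedean[OF e] by (auto simp: inverse_eq_divide add.commute)
    \<comment> \<open>The truncation at height \<open>a\<close> is compact, so a divergent sequence
      eventually stays below it, where \<open>q_small\<close> applies.\<close>
    define a where "a = 1 / (8 * real N + 1)"
    have a: "a > 0" by (simp add: a_def)
    have "compact {z \<in> half_open_rectangle. a \<le> Im z}"
      unfolding half_open_rectangle_truncation[OF a] by (rule compact_cbox)
    then have "\<forall>\<^sub>F n in sequentially. P n \<notin> {z \<in> half_open_rectangle. a \<le> Im z}"
      using P unfolding divergent_seq_in_def by blast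
    then show "\<forall>\<^sub>F n in sequentially. dist (q (P n)) 0 < e"
    proof (rule eventually_mono)
      fix n assume "P n \<notin> {z \<in> half_open_rectangle. a \<le> Im z}"
      moreover have "P n \<in> half_open_rectangle"
        using P by (simp add: divergent_seq_in_def)
      ultimately have "\<bar>q (P n)\<bar> \<le> 1 / (real N + 1)"
        by (intro q_small) (auto simp: a_def)
      then show "dist (q (P n)) 0 < e" using N by simp
    qed
  qed
  show ?thesis
    using mem proper q_nonpos q_lim unfolding q_def Let_def
    by (intro bexI[of _ X] conjI) blast+
qed

end
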